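(* Let $\mathcal{X}$ be a Higmanian scheme (in the sense defined in the context) with parameters $(f,m,n,k,t)$, where $f,m,n\geq 2$. Then $\mathcal{X}$ is uniform if and only if, for one choice of the sign $\pm$, $$t=\frac{k(f-2)}{mn}\left(mn-k\pm \sqrt{\frac{k(mn-k)}{m(n-1)}}\right).$$
   Context: An (association) scheme $\mathcal{X}$ on a finite set $\Omega$ is given by a partition $\mathcal{R}$ of $\Omega\times\Omega$ into basic relations containing the diagonal, closed under taking inverses, with the usual intersection numbers $p_{RS}^T$. It is symmetric if every basic relation equals its inverse; its rank is $|\mathcal{R}|$. A parabolic is an equivalence relation on $\Omega$ that is a union of basic relations; $\Omega/E$ is its set of classes and $n_E$ the common size of its classes. $\mathcal{X}$ is imprimitive if it has a parabolic other than the diagonal and $\Omega\times\Omega$, and indecomposable if it is not a wreath product of schemes. For a parabolic $E$, $\mathrm{cork}(E)$ is the rank of the quotient scheme $\mathcal{X}_{\Omega/E}$, and the valency $n_R$ of $R$ is $|\{\beta:(\alpha,\beta)\in R\}|$. A Higmanian scheme here means an imprimitive, symmetric, indecomposable scheme of rank $5$ having exactly two proper nontrivial parabolics $E\subsetneq F$. Let $S,T$ be the two basic relations not contained in $F$, labelled so that $n_T\le n_S$. Its parameters $(f,m,n,k,t)$ are: $f=|\Omega|/n_F$, $m=n_F/n_E$, $n=n_E$, $k=|\{\beta\in\Delta:(\alpha,\beta)\in S\}|$ for $\alpha\in\Omega$ and $\Delta\in\Omega/F$ not containing $\alpha$ (this number is independent of the choices), and $t=p_{TS}^{T}$. For $A$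 a $|\Omega|\times|\Omega|$ matrix and $\Delta,\Gamma\subseteq\Omega$, $A^{\Delta\Gamma}$ is the matrix agreeing with $A$ on entries $(x,y)$ with $x\in\Delta,y\in\Gamma$ and zero elsewhere. Let $A_0,\dots,A_d$ be the adjacency matrices of the basic relations $R_0,\dots,R_d$, and for $\Delta,\Gamma\in\Omega/E$ let $I(\Delta,\Gamma)=\{i: R_i\cap(\Delta\times\Gamma)\ne\varnothing\}$. A commutative scheme is uniform if it has a nontrivial parabolic $E$ with $\mathrm{cork}(E)=2$ such that for all $\Delta,\Gamma,\Lambda\in\Omega/E$, $i\in I(\Delta,\Gamma)$, $j\in I(\Gamma,\Lambda)$ there are nonnegative integers $a_{ij}^k$ with $A_i^{\Delta\Gamma}A_j^{\Gamma\Lambda}=\sum_{k=0}^d a_{ij}^kA_k^{\Delta\Lambda}$. *)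

theory Defs
  imports Complex_Main "HOL-Library.Disjoint_Sets"
begin

locale association_scheme =
  fixes \<Omega> :: "'a set" and \<R> :: "'a rel set"
  assumes finite_points: "finite \<Omega>"
    and partition: "partition_on (\<Omega> \<times> \<Omega>) \<R>"
    and diagonal: "Id_on \<Omega> \<in> \<R>"
    and converse_closed: "R \<in> \<R> \<Longrightarrow> R\<inverse> \<in> \<R>"
    and intersection_numbers:
      "\<lbrakk>R \<in> \<R>; S \<in> \<R>; T \<in> \<R>\<rbrakk> \<Longrightarrow>
        \<exists>p. \<forall>(\<alpha>, \<beta>) \<in> T. card {\<gamma> \<in> \<Omega>. (\<alpha>, \<gamma>) \<in> R \<and> (\<gamma>, \<beta>) \<in> S} = p"

definition intersection_number :: "'a set \<Rightarrow> 'a rel \<Rightarrow> 'a rel \<Rightarrow> 'a rel \<Rightarrow> nat" where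
  "intersection_number \<Omega> R S T =
    (THE p. \<forall>(\<alpha>, \<beta>) \<in> T. card {\<gamma> \<in> \<Omega>. (\<alpha>, \<gamma>) \<in> R \<and> (\<gamma>, \<beta>) \<in> S} = p)"

definition valency :: "'a set \<Rightarrow> 'a rel \<Rightarrow> nat" where
  "valency \<Omega> R = (THE c. \<forall>\<alpha> \<in> \<Omega>. card {\<beta> \<in> \<Omega>. (\<alpha>, \<beta>) \<in> R} = c)"

definition symmetric_scheme :: "'a rel set \<Rightarrow> bool" where
  "symmetric_scheme \<R> \<longleftrightarrow> (\<forall>R \<in> \<R>. R\<inverse> = R)"

definition commutative_scheme :: "'a set \<Rightarrow> 'a rel set \<Rightarrow> bool" where
  "commutative_scheme \<Omega> \<R> \<longleftrightarrow>
    (\<forall>R \<in> \<R>. \<forall>S \<in> \<R>. \<forall>T \<in> \<R>. intersection_number \<Omega> R S T = intersection_number \<Omega> S R T)"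

definition parabolic :: "'a set \<Rightarrow> 'a rel set \<Rightarrow> 'a rel \<Rightarrow> bool" where
  "parabolic \<Omega> \<R> E \<longleftrightarrow> equiv \<Omega> E \<and> (\<exists>\<S> \<subseteq> \<R>. E = \<Union>\<S>)"

definition proper_nontrivial_parabolics :: "'a set \<Rightarrow> 'a rel set \<Rightarrow> 'a rel set" where
  "proper_nontrivial_parabolics \<Omega> \<R> = {E. parabolic \<Omega> \<R> E \<and> E \<noteq> Id_on \<Omega> \<and> E \<noteq> \<Omega> \<times> \<Omega>}"

definition imprimitive :: "'a set \<Rightarrow> 'a rel set \<Rightarrow> bool" where
  "imprimitive \<Omega> \<R> \<longleftrightarrow> proper_nontrivial_parabolics \<Omega> \<R> \<noteq> {}"

definition class_size :: "'a set \<Rightarrow> 'a rel \<Rightarrow> nat" where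
  "class_size \<Omega> E = (THE n. \<forall>\<Delta> \<in> \<Omega> // E. card \<Delta> = n)"

definition quotient_rel :: "'a set \<Rightarrow> 'a rel \<Rightarrow> 'a rel \<Rightarrow> 'a set rel" where
  "quotient_rel \<Omega> E R =
    {(\<Delta>, \<Gamma>). \<Delta> \<in> \<Omega> // E \<and> \<Gamma> \<in> \<Omega> // E \<and> R \<inter> (\<Delta> \<times> \<Gamma>) \<noteq> {}}"

definition quotient_scheme :: "'a set \<Rightarrow> 'a rel set \<Rightarrow> 'a rel \<Rightarrow> 'a set rel set" where
  "quotient_scheme \<Omega> \<R> E = quotient_rel \<Omega> E ` \<R>"

definition cork :: "'a set \<Rightarrow> 'a rel set \<Rightarrow> 'a rel \<Rightarrow> nat" where
  "cork \<Omega> \<R> E = card (quotient_scheme \<Omega> \<R> E)"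

definition scheme_iso :: "'a set \<Rightarrow> 'a rel set \<Rightarrow> 'b set \<Rightarrow> 'b rel set \<Rightarrow> bool" where
  "scheme_iso \<Omega> \<R> \<Omega>' \<R>' \<longleftrightarrow>
    (\<exists>h. bij_betw h \<Omega> \<Omega>' \<and> (\<lambda>R. map_prod h h ` R) ` \<R> = \<R>')"

text \<open>
  The wreath product of schemes on \<open>\<Omega>\<^sub>1\<close> and \<open>\<Omega>\<^sub>2\<close> is a scheme on \<open>\<Omega>\<^sub>1 \<times> \<Omega>\<^sub>2\<close>: a copy of the
  first scheme on every fibre \<open>\<Omega>\<^sub>1 \<times> {u}\<close>, and the second scheme blown up between distinct fibres.
\<close>

definition wreath_product ::
    "'a set \<Rightarrow> 'a rel set \<Rightarrow> 'b set \<Rightarrow> 'b rel set \<Rightarrow> ('a \<times> 'b) rel set" where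
  "wreath_product \<Omega>\<^sub>1 \<R>\<^sub>1 \<Omega>\<^sub>2 \<R>\<^sub>2 =
    (\<lambda>R. {((a, u), (b, u)) | a b u. (a, b) \<in> R \<and> u \<in> \<Omega>\<^sub>2}) ` \<R>\<^sub>1 \<union>
    (\<lambda>R. {((a, u), (b, v)) | a b u v. a \<in> \<Omega>\<^sub>1 \<and> b \<in> \<Omega>\<^sub>1 \<and> (u, v) \<in> R}) ` (\<R>\<^sub>2 - {Id_on \<Omega>\<^sub>2})"

text \<open>
  Both factors must have at least two points, since every scheme is a wreath product with a
  one-point scheme. Factors on subsets of \<open>nat\<close> are no restriction: schemes are finite and only
  matter up to isomorphism.
\<close>

definition indecomposable :: "'a set \<Rightarrow> 'a rel set \<Rightarrow> bool" where
  "indecomposable \<Omega> \<R> \<longleftrightarrow>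
    \<not> (\<exists>(\<Omega>\<^sub>1 :: nat set) \<R>\<^sub>1 (\<Omega>\<^sub>2 :: nat set) \<R>\<^sub>2.
        association_scheme \<Omega>\<^sub>1 \<R>\<^sub>1 \<and> card \<Omega>\<^sub>1 \<ge> 2 \<and>
        association_scheme \<Omega>\<^sub>2 \<R>\<^sub>2 \<and> card \<Omega>\<^sub>2 \<ge> 2 \<and>
        scheme_iso \<Omega> \<R> (\<Omega>\<^sub>1 \<times> \<Omega>\<^sub>2) (wreath_product \<Omega>\<^sub>1 \<R>\<^sub>1 \<Omega>\<^sub>2 \<R>\<^sub>2))"

definition higmanian :: "'a set \<Rightarrow> 'a rel set \<Rightarrow> 'a rel \<Rightarrow> 'a rel \<Rightarrow> bool" where
  "higmanian \<Omega> \<R> E F \<longleftrightarrow>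
    association_scheme \<Omega> \<R> \<and> imprimitive \<Omega> \<R> \<and> symmetric_scheme \<R> \<and> indecomposable \<Omega> \<R> \<and>
    card \<R> = 5 \<and> proper_nontrivial_parabolics \<Omega> \<R> = {E, F} \<and> E \<subset> F"

definition higmanian_parameters ::
    "'a set \<Rightarrow> 'a rel \<Rightarrow> 'a rel \<Rightarrow> 'a rel \<Rightarrow> 'a rel \<Rightarrow> nat \<Rightarrow> nat \<Rightarrow> nat \<Rightarrow> nat \<Rightarrow> nat \<Rightarrow> bool" where
  "higmanian_parameters \<Omega> E F S T f m n k t \<longleftrightarrow>
    real f = real (card \<Omega>) / real (class_size \<Omega> F) \<and>
    real m = real (class_size \<Omega> F) / real (class_size \<Omega> E) \<and>
    n = class_size \<Omega> E \<and>
    k = (THE c. \<forall>\<alpha> \<in> \<Omega>. \<forall>\<Delta> \<in> \<Omega> // F. \<alpha> \<notin> \<Delta> \<longrightarrow> card {\<beta> \<in> \<Delta>. (\<alpha>, \<beta>) \<in> S} = c) \<and>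
    t = intersection_number \<Omega> T S T"

text \<open>
  Matrices with rows and columns indexed by \<open>\<Omega>\<close> are functions of two arguments; basic relations
  serve as their own indices, in place of an enumeration \<open>R\<^sub>0, \<dots>, R\<^sub>d\<close>.
\<close>

definition adjacency :: "'a rel \<Rightarrow> 'a \<Rightarrow> 'a \<Rightarrow> int" where
  "adjacency R x y = (if (x, y) \<in> R then 1 else 0)"

definition block :: "('a \<Rightarrow> 'a \<Rightarrow> int) \<Rightarrow> 'a set \<Rightarrow> 'a set \<Rightarrow> 'a \<Rightarrow> 'a \<Rightarrow> int" where
  "block A \<Delta> \<Gamma> x y = (if x \<in> \<Delta> \<and> y \<in> \<Gamma> then A x y else 0)"

definition matrix_product ::
    "'a set \<Rightarrow> ('a \<Rightarrow> 'a \<Rightarrow> int) \<Rightarrow> ('a \<Rightarrow> 'a \<Rightarrow> int) \<Rightarrow> 'a \<Rightarrow> 'a \<Rightarrow> int" where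
  "matrix_product \<Omega> A B x y = (\<Sum>z\<in>\<Omega>. A x z * B z y)"

definition meeting_rels :: "'a rel set \<Rightarrow> 'a set \<Rightarrow> 'a set \<Rightarrow> 'a rel set" where
  "meeting_rels \<R> \<Delta> \<Gamma> = {R \<in> \<R>. R \<inter> (\<Delta> \<times> \<Gamma>) \<noteq> {}}"

text \<open>
  The coefficients \<open>a P Q R\<close> depend only on the three basic relations, not on the classes
  \<open>\<Delta>\<close>, \<open>\<Gamma>\<close>, \<open>\<Lambda>\<close>.
\<close>

definition uniform :: "'a set \<Rightarrow> 'a rel set \<Rightarrow> bool" where
  "uniform \<Omega> \<R> \<longleftrightarrow>
    association_scheme \<Omega> \<R> \<and> commutative_scheme \<Omega> \<R> \<and>
    (\<exists>E. parabolic \<Omega> \<R> E \<and> E \<noteq> Id_on \<Omega> \<and> cork \<Omega> \<R> E = 2 \<and>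
      (\<exists>a :: 'a rel \<Rightarrow> 'a rel \<Rightarrow> 'a rel \<Rightarrow> nat.
        \<forall>\<Delta> \<in> \<Omega> // E. \<forall>\<Gamma> \<in> \<Omega> // E. \<forall>\<Lambda> \<in> \<Omega> // E.
        \<forall>P \<in> meeting_rels \<R> \<Delta> \<Gamma>. \<forall>Q \<in> meeting_rels \<R> \<Gamma> \<Lambda>.
        \<forall>x \<in> \<Omega>. \<forall>y \<in> \<Omega>.
          matrix_product \<Omega> (block (adjacency P) \<Delta> \<Gamma>) (block (adjacency Q) \<Gamma> \<Lambda>) x y =
          (\<Sum>R\<in>\<R>. int (a P Q R) * block (adjacency R) \<Delta> \<Lambda> x y)))"

end

theory Submission
  imports Defs
begin

text \<open>
  The five basic relations are the diagonal, \<open>R1 = E - 1\<close>, \<open>R2 = F - E\<close>, \<open>S\<close> and \<open>T\<close>. If some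
  \<open>E\<close>-class outside \<open>F(x)\<close> missed \<open>S(x)\<close> or \<open>T(x)\<close>, then \<open>S\<close> and \<open>T\<close> would be unions of blocks of
  \<open>E\<close> and the scheme a wreath product; hence \<open>S(x)\<close> meets all those classes in the same number \<open>r\<close>
  of points, \<open>0 < r < n\<close>, and \<open>k = m r\<close>.

  Let \<open>C\<close> be the matrix of \<open>S\<close> with its mean \<open>r / n\<close> subtracted off \<open>F\<close>, and let \<open>P\<close> project onto
  the functions with sum zero on every \<open>E\<close>-class. Then \<open>P C = C\<close> and \<open>C\<^sup>2 = (f - 1) D P + e C\<close> with
  \<open>D = k (m n - k) / (m (n - 1))\<close> and \<open>e\<close> an affine function of \<open>t\<close>. The formula for \<open>t\<close> says exactly
  that \<open>e = (f - 2) \<delta>\<close> with \<open>\<delta>\<^sup>2 = D\<close>.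

  Uniformity means that the products of the blocks of \<open>C\<close> through a single \<open>F\<close>-class do not depend on
  that class, so they are \<open>D P\<close> or \<open>\<delta> C\<close>; associativity of a product of three blocks then gives
  \<open>\<delta>\<^sup>2 = D\<close>. Conversely, if \<open>\<delta>\<^sup>2 = D\<close>, then \<open>L = P + C / \<delta>\<close> satisfies \<open>L\<^sup>2 = f L\<close> and has the
  projection \<open>P\<close> as its diagonal blocks. For a class \<open>\<Gamma>\<close> with coordinate projection \<open>I\<^sub>\<Gamma>\<close> the Schur
  complement \<open>X\<^sub>\<Gamma> = L - L I\<^sub>\<Gamma> L\<close> satisfies \<open>X\<^sub>\<Gamma>\<^sup>2 = f X\<^sub>\<Gamma>\<close>, hence is positive semidefinite, while
  \<open>\<Sum>\<^sub>\<Gamma> X\<^sub>\<Gamma> = f L - L\<^sup>2 = 0\<close>. So every \<open>X\<^sub>\<Gamma>\<close> vanishes, which is uniformity.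
\<close>

section \<open>Matrices with \<open>L\<^sup>2 = f L\<close>\<close>

text \<open>\<open>blk\<close> says that the diagonal block of \<open>L\<close> at a class acts as
  the identity on the rows of that class. Positive semidefiniteness of the Schur complement
  \<open>X G\<close> enters only through its diagonal: \<open>(X G)\<^sup>2 = c X G\<close> makes
  \<open>c\<close> times each diagonal entry a sum of squares, these entries add up to 0 over the
  classes, and a zero diagonal entry kills its whole row.\<close>

lemma block_idempotent:
  fixes L :: "'a \<Rightarrow> 'a \<Rightarrow> real"
  assumes fin: "finite \<Omega>" and part: "partition_on \<Omega> \<P>"
    and sym: "\<And>x y. L x y = L y x"
    and sq: "\<And>x y. x \<in> \<Omega> \<Longrightarrow> y \<in> \<Omega> \<Longrightarrow>
      (\<Sum>z\<in>\<Omega>. L x z * L z y) = real (card \<P>) * L x y"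
    and blk: "\<And>\<Gamma> x y. \<Gamma> \<in> \<P> \<Longrightarrow> x \<in> \<Gamma> \<Longrightarrow> y \<in> \<Omega> \<Longrightarrow>
      (\<Sum>z\<in>\<Gamma>. L x z * L z y) = L x y"
    and \<Gamma>: "\<Gamma> \<in> \<P>" and xy: "x \<in> \<Omega>" "y \<in> \<Omega>"
  shows "(\<Sum>z\<in>\<Gamma>. L x z * L z y) = L x y"
proof -
  define c where "c = real (card \<P>)"
  define X where "X G u v = L u v - (\<Sum>z\<in>G. L u z * L z v)" for G u v
  have finP: "finite \<P>"
    using finite_elements[OF fin part] .
  have sub: "G \<subseteq> \<Omega>" if "G \<in> \<P>" for G
    using part that by (auto simp: partition_on_def)
  have finG: "finite G" if "G \<in> \<P>" for G
    using sub[OF that] fin finite_subset by blast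
  have cpos: "c > 0"
    using \<Gamma> finP by (auto simp: c_def card_gt_0_iff)
  \<comment> \<open>Diagonal entry of \<open>X\<^sup>2 = c X\<close>. With J the coordinate
    projection onto \<open>G\<close>, \<open>s1\<close>, \<open>s2\<close> and \<open>s3\<close>
    compute the diagonals of \<open>L L\<close>, \<open>L (L J L)\<close> and
    \<open>(L J L) (L J L)\<close>; only \<open>s3\<close> needs \<open>blk\<close>, to reduce
    \<open>L J L J L\<close> to \<open>L J L\<close>.\<close>
  have sqX: "(\<Sum>v\<in>\<Omega>. (X G u v)\<^sup>2) = c * X G u u" if G: "G \<in> \<P>" and u: "u \<in> \<Omega>" for G u
  proof -
    have Gm: "z \<in> \<Omega>" if "z \<in> G" for z
      using sub[OF G] that by blast
    have s1: "(\<Sum>v\<in>\<Omega>. L u v * L u v) = c * L u u"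
      unfolding c_def sq[OF u u, symmetric] by (intro sum.cong refl) (metis sym)
    have s2: "(\<Sum>v\<in>\<Omega>. L u v * (\<Sum>z\<in>G. L u z * L z v)) = c * (\<Sum>z\<in>G. L u z * L z u)"
    proof -
      have "(\<Sum>v\<in>\<Omega>. L u v * (\<Sum>z\<in>G. L u z * L z v)) = (\<Sum>v\<in>\<Omega>. \<Sum>z\<in>G. L u z * (L z v * L v u))"
        unfolding sum_distrib_left by (intro sum.cong refl) (metis sym mult.commute mult.left_commute)
      also have "\<dots> = (\<Sum>z\<in>G. L u z * (\<Sum>v\<in>\<Omega>. L z v * L v u))"
        by (subst sum.swap) (simp add: sum_distrib_left)
      also have "\<dots> = (\<Sum>z\<in>G. L u z * (c * L z u))"
        by (intro sum.cong) (simp_all add: sq Gm u c_def)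
      finally show ?thesis by (simp add: sum_distrib_left mult_ac)
    qed
    have s3: "(\<Sum>v\<in>\<Omega>. (\<Sum>z\<in>G. L u z * L z v) * (\<Sum>w\<in>G. L u w * L w v)) = c * (\<Sum>z\<in>G. L u z * L z u)"
    proof -
      have "(\<Sum>v\<in>\<Omega>. (\<Sum>z\<in>G. L u z * L z v) * (\<Sum>w\<in>G. L u w * L w v))
          = (\<Sum>v\<in>\<Omega>. \<Sum>z\<in>G. \<Sum>w\<in>G. L u z * (L w u * (L z v * L v w)))"
        unfolding sum_product
        by (intro sum.cong refl) (metis sym mult.assoc mult.commute mult.left_commute)
      also have "\<dots> = (\<Sum>z\<in>G. \<Sum>v\<in>\<Omega>. \<Sum>w\<in>G. L u z * (L w u * (L z v * L v w)))"
        by (rule sum.swap)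
      also have "\<dots> = (\<Sum>z\<in>G. \<Sum>w\<in>G. \<Sum>v\<in>\<Omega>. L u z * (L w u * (L z v * L v w)))"
        by (intro sum.cong refl sum.swap)
      also have "\<dots> = (\<Sum>z\<in>G. \<Sum>w\<in>G. L u z * (L w u * (c * L z w)))"
        by (intro sum.cong refl) (simp add: sum_distrib_left[symmetric] sq Gm c_def)
      also have "\<dots> = (\<Sum>z\<in>G. c * (L u z * (\<Sum>w\<in>G. L z w * L w u)))"
        by (simp add: sum_distrib_left mult_ac)
      also have "\<dots> = (\<Sum>z\<in>G. c * (L u z * L z u))"
        by (intro sum.cong refl) (simp add: blk[OF G _ u])
      finally show ?thesis by (simp add: sum_distrib_left)
    qed
    have "(\<Sum>v\<in>\<Omega>. (X G u v)\<^sup>2) = (\<Sum>v\<in>\<Omega>. L u v * L u v) - 2 * (\<Sum>v\<in>\<Omega>. L u v * (\<Sum>z\<in>G. L u z * L z v))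
        + (\<Sum>v\<in>\<Omega>. (\<Sum>z\<in>G. L u z * L z v) * (\<Sum>w\<in>G. L u w * L w v))"
      by (simp add: X_def power2_eq_square algebra_simps sum.distrib sum_subtractf sum_distrib_left)
    then show ?thesis
      unfolding s1 s2 s3 by (simp add: X_def algebra_simps)
  qed
  have nonneg: "X G u u \<ge> 0" if "G \<in> \<P>" "u \<in> \<Omega>" for G u
  proof -
    have "c * X G u u \<ge> 0"
      unfolding sqX[OF that, symmetric] by (intro sum_nonneg) simp
    then show ?thesis using cpos by (simp add: zero_le_mult_iff)
  qed
  \<comment> \<open>The classes partition \<open>\<Omega>\<close>, so the sum is the diagonal entry
    of \<open>c L - L\<^sup>2\<close>, which is 0 by \<open>sq\<close>.\<close>
  have "(\<Sum>G\<in>\<P>. X G x x) = c * L x x - (\<Sum>G\<in>\<P>. \<Sum>z\<in>G. L x z * L z x)"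
    by (simp add: X_def sum_subtractf c_def)
  also have "(\<Sum>G\<in>\<P>. \<Sum>z\<in>G. L x z * L z x) = (\<Sum>z\<in>\<Union>\<P>. L x z * L z x)"
    using finG part by (subst sum.Union_disjoint) (auto simp: partition_on_def disjoint_def)
  also have "\<Union>\<P> = \<Omega>"
    using part by (simp add: partition_on_def)
  finally have "(\<Sum>G\<in>\<P>. X G x x) = 0"
    by (simp add: sq xy c_def)
  then have "X \<Gamma> x x = 0"
    using finP \<Gamma> nonneg xy by (subst (asm) sum_nonneg_eq_0_iff) auto
  then have "(\<Sum>v\<in>\<Omega>. (X \<Gamma> x v)\<^sup>2) = 0"
    by (simp add: sqX[OF \<Gamma> xy(1)])
  then have "X \<Gamma> x y = 0"
    using fin xy by (subst (asm) sum_nonneg_eq_0_iff) auto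
  then show ?thesis by (simp add: X_def)
qed

section \<open>Association schemes\<close>

context association_scheme
begin

section \<open>Basic relations and path counting\<close>

lemma rel_subset: "R \<in> \<R> \<Longrightarrow> R \<subseteq> \<Omega> \<times> \<Omega>"
  using partition by (auto simp: partition_on_def)

lemma rel_nonempty: "R \<in> \<R> \<Longrightarrow> R \<noteq> {}"
  using partition by (auto simp: partition_on_def)

lemma rel_unique: "R \<in> \<R> \<Longrightarrow> R' \<in> \<R> \<Longrightarrow> p \<in> R \<Longrightarrow> p \<in> R' \<Longrightarrow> R = R'"
  using partition by (auto simp: partition_on_def disjoint_def)

lemma rel_exists: "x \<in> \<Omega> \<Longrightarrow> y \<in> \<Omega> \<Longrightarrow> \<exists>R\<in>\<R>. (x, y) \<in> R"
  using partition by (auto simp: partition_on_def)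

lemma finite_rels: "finite \<R>"
  using finite_elements[OF _ partition] finite_points by simp

lemma card_paths:
  assumes "R \<in> \<R>" "Q \<in> \<R>" "U \<in> \<R>" "(x, y) \<in> U"
  shows "card {z \<in> \<Omega>. (x, z) \<in> R \<and> (z, y) \<in> Q} = intersection_number \<Omega> R Q U"
proof -
  obtain p where p: "\<forall>(x, y)\<in>U. card {z \<in> \<Omega>. (x, z) \<in> R \<and> (z, y) \<in> Q} = p"
    using intersection_numbers[OF assms(1-3)] by blast
  then have "intersection_number \<Omega> R Q U = p"
    unfolding intersection_number_def using assms(4) by (intro the_equality) auto
  with p assms(4) show ?thesis by auto
qed

text \<open>Reversing a path from \<open>x\<close> to \<open>y\<close> exchanges the two factors,
  and symmetry puts \<open>(y, x)\<close> into the same relation as \<open>(x, y)\<close>.\<close>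

lemma symmetric_imp_commutative:
  assumes "symmetric_scheme \<R>"
  shows "commutative_scheme \<Omega> \<R>"
  unfolding commutative_scheme_def
proof (intro ballI)
  fix R Q U assume R: "R \<in> \<R>" "Q \<in> \<R>" "U \<in> \<R>"
  then obtain x y where xy: "(x, y) \<in> U"
    using rel_nonempty by fast
  have sym: "(a, b) \<in> V \<longleftrightarrow> (b, a) \<in> V" if "V \<in> \<R>" for a b V
    using assms that unfolding symmetric_scheme_def by blast
  have "{z \<in> \<Omega>. (x, z) \<in> R \<and> (z, y) \<in> Q} = {z \<in> \<Omega>. (y, z) \<in> Q \<and> (z, x) \<in> R}"
    using sym[OF R(1), of x] sym[OF R(2), of y] by blast
  moreover have "(y, x) \<in> U"
    using sym[OF R(3)] xy by blast
  ultimately show "intersection_number \<Omega> R Q U = intersection_number \<Omega> Q R U"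
    using card_paths[OF R xy] card_paths[OF R(2,1,3), of y x] by simp
qed

text \<open>Read entrywise, both sides of the matrix identity vanish outside \<Delta> \<times>
  \<Lambda>. Inside, the right side keeps only the coefficient of the relation containing
  \<open>(x, y)\<close>, and the left side counts paths with midpoint in \<Gamma>. The rest of the
  proof works with these counts.\<close>

lemma uniform_blocks_iff:
  assumes equiv: "equiv \<Omega> G"
  shows "(\<forall>\<Delta> \<in> \<Omega> // G. \<forall>\<Gamma> \<in> \<Omega> // G. \<forall>\<Lambda> \<in> \<Omega> // G.
        \<forall>P \<in> meeting_rels \<R> \<Delta> \<Gamma>. \<forall>Q \<in> meeting_rels \<R> \<Gamma> \<Lambda>. \<forall>x \<in> \<Omega>. \<forall>y \<in> \<Omega>.
          matrix_product \<Omega> (block (adjacency P) \<Delta> \<Gamma>) (block (adjacency Q) \<Gamma> \<Lambda>) x y =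
          (\<Sum>R\<in>\<R>. int (a P Q R) * block (adjacency R) \<Delta> \<Lambda> x y)) \<longleftrightarrow>
    (\<forall>\<Delta> \<in> \<Omega> // G. \<forall>\<Gamma> \<in> \<Omega> // G. \<forall>\<Lambda> \<in> \<Omega> // G.
        \<forall>P \<in> meeting_rels \<R> \<Delta> \<Gamma>. \<forall>Q \<in> meeting_rels \<R> \<Gamma> \<Lambda>.
        \<forall>x \<in> \<Delta>. \<forall>y \<in> \<Lambda>. \<forall>R \<in> \<R>. (x, y) \<in> R \<longrightarrow>
          card {z \<in> \<Gamma>. (x, z) \<in> P \<and> (z, y) \<in> Q} = a P Q R)"
proof -
  have sub: "\<Delta> \<subseteq> \<Omega>" if "\<Delta> \<in> \<Omega> // G" for \<Delta>
    using that equiv by (meson in_quotient_imp_subset)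
  have prod: "matrix_product \<Omega> (block (adjacency P) \<Delta> \<Gamma>) (block (adjacency Q) \<Gamma> \<Lambda>) x y =
      (if x \<in> \<Delta> \<and> y \<in> \<Lambda> then int (card {z \<in> \<Gamma>. (x, z) \<in> P \<and> (z, y) \<in> Q}) else 0)"
    if "\<Gamma> \<subseteq> \<Omega>" for \<Delta> \<Gamma> \<Lambda> P Q x y
  proof (cases "x \<in> \<Delta> \<and> y \<in> \<Lambda>")
    case True
    then have "matrix_product \<Omega> (block (adjacency P) \<Delta> \<Gamma>) (block (adjacency Q) \<Gamma> \<Lambda>) x y =
        (\<Sum>z\<in>\<Omega>. if z \<in> \<Gamma> \<and> (x, z) \<in> P \<and> (z, y) \<in> Q then 1 else 0)"
      unfolding matrix_product_def block_def adjacency_def by (intro sum.cong) auto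
    also have "\<dots> = (\<Sum>z\<in>{z \<in> \<Omega>. z \<in> \<Gamma> \<and> (x, z) \<in> P \<and> (z, y) \<in> Q}. 1)"
      by (simp only: sum.inter_filter[OF finite_points])
    also have "{z \<in> \<Omega>. z \<in> \<Gamma> \<and> (x, z) \<in> P \<and> (z, y) \<in> Q} = {z \<in> \<Gamma>. (x, z) \<in> P \<and> (z, y) \<in> Q}"
      using that by blast
    finally show ?thesis using True by simp
  qed (auto simp: matrix_product_def block_def)
  have comb: "(\<Sum>R\<in>\<R>. int (a P Q R) * block (adjacency R) \<Delta> \<Lambda> x y) =
      (if x \<in> \<Delta> \<and> y \<in> \<Lambda> then int (a P Q U) else 0)"
    if "U \<in> \<R>" "(x, y) \<in> U" for P Q \<Delta> \<Lambda> x y U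
  proof -
    have "(x, y) \<in> R \<longleftrightarrow> R = U" if "R \<in> \<R>" for R
      using rel_unique that \<open>U \<in> \<R>\<close> \<open>(x, y) \<in> U\<close> by blast
    then have "(\<Sum>R\<in>\<R>. int (a P Q R) * block (adjacency R) \<Delta> \<Lambda> x y) =
        (\<Sum>R\<in>\<R>. if R = U then (if x \<in> \<Delta> \<and> y \<in> \<Lambda> then int (a P Q U) else 0) else 0)"
      unfolding block_def adjacency_def by (intro sum.cong) auto
    also have "\<dots> = (if x \<in> \<Delta> \<and> y \<in> \<Lambda> then int (a P Q U) else 0)"
      using finite_rels that by simp
    finally show ?thesis .
  qed
  have entry: "(\<forall>x\<in>\<Omega>. \<forall>y\<in>\<Omega>.
          matrix_product \<Omega> (block (adjacency P) \<Delta> \<Gamma>) (block (adjacency Q) \<Gamma> \<Lambda>) x y =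
          (\<Sum>R\<in>\<R>. int (a P Q R) * block (adjacency R) \<Delta> \<Lambda> x y)) \<longleftrightarrow>
      (\<forall>x \<in> \<Delta>. \<forall>y \<in> \<Lambda>. \<forall>R \<in> \<R>. (x, y) \<in> R \<longrightarrow>
          card {z \<in> \<Gamma>. (x, z) \<in> P \<and> (z, y) \<in> Q} = a P Q R)" (is "?l = ?r")
    if "\<Delta> \<subseteq> \<Omega>" "\<Gamma> \<subseteq> \<Omega>" "\<Lambda> \<subseteq> \<Omega>" for \<Delta> \<Gamma> \<Lambda> P Q
  proof
    assume ?l
    show ?r
    proof (intro ballI impI)
      fix x y R assume "x \<in> \<Delta>" "y \<in> \<Lambda>" "R \<in> \<R>" "(x, y) \<in> R"
      moreover from this have "x \<in> \<Omega>" "y \<in> \<Omega>" using that by auto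
      ultimately show "card {z \<in> \<Gamma>. (x, z) \<in> P \<and> (z, y) \<in> Q} = a P Q R"
        using \<open>?l\<close> prod[OF that(2), of P \<Delta> Q \<Lambda> x y] comb[of R x y P Q \<Delta> \<Lambda>] by simp
    qed
  next
    assume ?r
    show ?l
    proof (intro ballI)
      fix x y assume "x \<in> \<Omega>" "y \<in> \<Omega>"
      then obtain R where "R \<in> \<R>" "(x, y) \<in> R" using rel_exists by blast
      then show "matrix_product \<Omega> (block (adjacency P) \<Delta> \<Gamma>) (block (adjacency Q) \<Gamma> \<Lambda>) x y =
          (\<Sum>R\<in>\<R>. int (a P Q R) * block (adjacency R) \<Delta> \<Lambda> x y)"
        using \<open>?r\<close> prod[OF that(2), of P \<Delta> Q \<Lambda> x y] comb[of R x y P Q \<Delta> \<Lambda>] by simp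
    qed
  qed
  show ?thesis
    by (rule ball_cong[OF refl])+ (rule entry; simp only: sub)
qed

text \<open>The pair \<open>(A, B)\<close> used by a path is determined by its midpoint, so the
  counts add up. Quotients need this form, since a relation between classes lifts to a union of
  basic relations.\<close>

lemma card_paths_Union:
  assumes A: "\<A> \<subseteq> \<R>" and B: "\<B> \<subseteq> \<R>" and U: "U \<in> \<R>" "(x, y) \<in> U"
  shows "card {z \<in> \<Omega>. (x, z) \<in> \<Union>\<A> \<and> (z, y) \<in> \<Union>\<B>} =
    (\<Sum>(A, B)\<in>\<A> \<times> \<B>. intersection_number \<Omega> A B U)"
proof -
  have fin: "finite (\<A> \<times> \<B>)"
    using finite_rels A B finite_subset by blast
  have "{z \<in> \<Omega>. (x, z) \<in> \<Union>\<A> \<and> (z, y) \<in> \<Union>\<B>} =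
      (\<Union>p\<in>\<A> \<times> \<B>. {z \<in> \<Omega>. (x, z) \<in> fst p \<and> (z, y) \<in> snd p})"
    by force
  also have "card \<dots> = (\<Sum>p\<in>\<A> \<times> \<B>. card {z \<in> \<Omega>. (x, z) \<in> fst p \<and> (z, y) \<in> snd p})"
  proof (rule card_UN_disjoint[OF fin])
    show "\<forall>p\<in>\<A> \<times> \<B>. finite {z \<in> \<Omega>. (x, z) \<in> fst p \<and> (z, y) \<in> snd p}"
      using finite_points by simp
    show "\<forall>p\<in>\<A> \<times> \<B>. \<forall>q\<in>\<A> \<times> \<B>. p \<noteq> q \<longrightarrow>
        {z \<in> \<Omega>. (x, z) \<in> fst p \<and> (z, y) \<in> snd p} \<inter> {z \<in> \<Omega>. (x, z) \<in> fst q \<and> (z, y) \<in> snd q} = {}"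
    proof (intro ballI impI)
      fix p q assume "p \<in> \<A> \<times> \<B>" "q \<in> \<A> \<times> \<B>" "p \<noteq> q"
      then have "fst p \<in> \<R>" "fst q \<in> \<R>" "snd p \<in> \<R>" "snd q \<in> \<R>" "fst p \<noteq> fst q \<or> snd p \<noteq> snd q"
        using A B by (auto simp: prod_eq_iff)
      then show "{z \<in> \<Omega>. (x, z) \<in> fst p \<and> (z, y) \<in> snd p} \<inter> {z \<in> \<Omega>. (x, z) \<in> fst q \<and> (z, y) \<in> snd q} = {}"
        using rel_unique by blast
    qed
  qed
  also have "\<dots> = (\<Sum>(A, B)\<in>\<A> \<times> \<B>. intersection_number \<Omega> A B U)"
    using A B U by (intro sum.cong refl) (auto intro!: card_paths)
  finally show ?thesis .
qed

section \<open>Parabolics, class sizes and the trivial quotient\<close>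

lemma rel_containing: "p \<in> \<Omega> \<times> \<Omega> \<Longrightarrow> \<exists>R\<in>\<R>. p \<in> R"
  using partition by (auto simp: partition_on_def)

lemma rel_sub_or_disjoint:
  assumes "\<S> \<subseteq> \<R>" "R \<in> \<R>"
  shows "R \<subseteq> \<Union>\<S> \<or> R \<inter> \<Union>\<S> = {}"
proof (cases "R \<in> \<S>")
  case False
  then show ?thesis
    using rel_unique[OF assms(2)] assms(1) by blast
qed blast

text \<open>A neighbour of \<open>z\<close> along \<open>\<Union>\<S>\<close> is the midpoint of a
  closed path that returns along an arbitrary relation, so the number of neighbours is a sum of
  intersection numbers at the diagonal.\<close>

lemma card_Image_Union:
  assumes "\<S> \<subseteq> \<R>" "x \<in> \<Omega>" "y \<in> \<Omega>"
  shows "card (\<Union>\<S> `` {x}) = card (\<Union>\<S> `` {y})"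
proof -
  have all: "\<Union>\<R> = \<Omega> \<times> \<Omega>"
    using partition by (simp add: partition_on_def)
  have "card (\<Union>\<S> `` {z}) = (\<Sum>(A, B)\<in>\<S> \<times> \<R>. intersection_number \<Omega> A B (Id_on \<Omega>))" if "z \<in> \<Omega>" for z
  proof -
    have "\<Union>\<S> `` {z} = {w \<in> \<Omega>. (z, w) \<in> \<Union>\<S> \<and> (w, z) \<in> \<Union>\<R>}"
      unfolding all using assms(1) rel_subset that by blast
    then show ?thesis
      using card_paths_Union[OF assms(1) subset_refl diagonal, of z z] that by auto
  qed
  then show ?thesis using assms by simp
qed

text \<open>By \<open>card_Image_Union\<close> all classes have equal size, so the definite
  description in \<open>class_size\<close> denotes that size.\<close>

lemma card_class:
  assumes "parabolic \<Omega> \<R> G" "x \<in> \<Omega>"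
  shows "card (G `` {x}) = class_size \<Omega> G"
proof -
  obtain \<S> where \<S>: "\<S> \<subseteq> \<R>" "G = \<Union>\<S>"
    using assms(1) by (auto simp: parabolic_def)
  have all: "card \<Delta> = card (G `` {x})" if \<Delta>: "\<Delta> \<in> \<Omega> // G" for \<Delta>
  proof -
    obtain y where "y \<in> \<Omega>" "\<Delta> = G `` {y}"
      using \<Delta> by (rule quotientE)
    then show ?thesis
      using card_Image_Union[OF \<S>(1) _ assms(2), of y] \<S>(2) by simp
  qed
  show ?thesis
    unfolding class_size_def
  proof (rule the_equality[symmetric])
    show "\<forall>\<Delta>\<in>\<Omega> // G. card \<Delta> = card (G `` {x})"
      using all by blast
    show "c = card (G `` {x})" if "\<forall>\<Delta>\<in>\<Omega> // G. card \<Delta> = c" for c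
      using that quotientI[OF assms(2)] by metis
  qed
qed

lemma card_quotient_class_size:
  assumes "parabolic \<Omega> \<R> G"
  shows "card \<Omega> = card (\<Omega> // G) * class_size \<Omega> G"
proof -
  have eq: "equiv \<Omega> G"
    using assms by (simp add: parabolic_def)
  have part: "partition_on \<Omega> (\<Omega> // G)"
    by (rule partition_on_quotient[OF eq])
  have "card \<Omega> = card (\<Union>(\<Omega> // G))"
    using part by (simp add: partition_on_def)
  also have "\<dots> = (\<Sum>\<Delta>\<in>\<Omega> // G. card \<Delta>)"
    using part finite_subset[OF in_quotient_imp_subset[OF eq] finite_points]
    by (intro card_Union_disjoint) (auto simp: partition_on_def disjoint_def pairwise_def disjnt_def)
  also have "\<dots> = (\<Sum>\<Delta>\<in>\<Omega> // G. class_size \<Omega> G)"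
    using card_class[OF assms] by (intro sum.cong refl) (metis quotientE)
  finally show ?thesis by simp
qed

text \<open>\<open>uniform\<close> admits the full relation as a parabolic; its corank 1 is what
  excludes it.\<close>

lemma cork_full:
  assumes "\<Omega> \<noteq> {}"
  shows "cork \<Omega> \<R> (\<Omega> \<times> \<Omega>) = 1"
proof -
  have "\<Omega> // (\<Omega> \<times> \<Omega>) = {\<Omega>}"
    using assms by (auto simp: quotient_def)
  then have "quotient_rel \<Omega> (\<Omega> \<times> \<Omega>) R = {(\<Omega>, \<Omega>)}" if "R \<in> \<R>" for R
    using rel_subset[OF that] rel_nonempty[OF that] by (auto simp: quotient_rel_def)
  then have "quotient_scheme \<Omega> \<R> (\<Omega> \<times> \<Omega>) = {{(\<Omega>, \<Omega>)}}"
    using diagonal by (auto simp: quotient_scheme_def)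
  then show ?thesis by (simp add: cork_def)
qed

end

section \<open>Wreath products\<close>

text \<open>Serves as the inner factor of the wreath product. On a single point the complement of
  the diagonal would be empty and could not be a basic relation.\<close>

lemma trivial_scheme:
  assumes fin: "finite A" and two: "card A \<ge> 2"
  shows "association_scheme A {Id_on A, A \<times> A - Id_on A}"
proof
  obtain a b where ab: "a \<in> A" "b \<in> A" "a \<noteq> b"
    using two by (metis card_le_Suc0_iff_eq fin not_less_eq_eq numeral_2_eq_2)
  then have "Id_on A \<noteq> {}" "A \<times> A - Id_on A \<noteq> {}"
    by auto
  then show "partition_on (A \<times> A) {Id_on A, A \<times> A - Id_on A}"
    by (auto simp: partition_on_def disjoint_def)
  show "R\<inverse> \<in> {Id_on A, A \<times> A - Id_on A}" if "R \<in> {Id_on A, A \<times> A - Id_on A}" for R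
  proof -
    have "(Id_on A)\<inverse> = Id_on A" "(A \<times> A - Id_on A)\<inverse> = A \<times> A - Id_on A"
      by auto
    then show ?thesis using that by auto
  qed
  show "\<exists>p. \<forall>(x, y)\<in>U. card {z \<in> A. (x, z) \<in> R \<and> (z, y) \<in> Q} = p"
    if R: "R \<in> {Id_on A, A \<times> A - Id_on A}" and Q: "Q \<in> {Id_on A, A \<times> A - Id_on A}"
      and U: "U \<in> {Id_on A, A \<times> A - Id_on A}" for R Q U
  proof -
    have U_sub: "x \<in> A \<and> y \<in> A" if "(x, y) \<in> U" for x y
      using U that by auto
    have mem: "(x, y) \<in> V \<longleftrightarrow> V = U" if "(x, y) \<in> U" "V \<in> {Id_on A, A \<times> A - Id_on A}" for x y V
      using U that by auto
    consider "R = Id_on A" | "Q = Id_on A" | "R = A \<times> A - Id_on A" "Q = A \<times> A - Id_on A"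
      using R Q by auto
    then show ?thesis
    proof cases
      case 1
      have "card {z \<in> A. (x, z) \<in> R \<and> (z, y) \<in> Q} = (if Q = U then 1 else 0)" if "(x, y) \<in> U" for x y
      proof -
        have "{z \<in> A. (x, z) \<in> R \<and> (z, y) \<in> Q} = (if Q = U then {x} else {})"
          using mem[OF that Q] U_sub[OF that] 1 by auto
        then show ?thesis by simp
      qed
      then show ?thesis by blast
    next
      case 2
      have "card {z \<in> A. (x, z) \<in> R \<and> (z, y) \<in> Q} = (if R = U then 1 else 0)" if "(x, y) \<in> U" for x y
      proof -
        have "{z \<in> A. (x, z) \<in> R \<and> (z, y) \<in> Q} = (if R = U then {y} else {})"
          using mem[OF that R] U_sub[OF that] 2 by auto
        then show ?thesis by simp
      qed
      then show ?thesis by blast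
    next
      case 3
      have "card {z \<in> A. (x, z) \<in> R \<and> (z, y) \<in> Q} = card A - (if U = Id_on A then 1 else 2)"
        if xy: "(x, y) \<in> U" for x y
      proof -
        have "{z \<in> A. (x, z) \<in> R \<and> (z, y) \<in> Q} = A - {x, y}"
          using 3 U_sub[OF xy] by auto
        moreover have "x = y \<longleftrightarrow> U = Id_on A"
          using U xy U_sub[OF xy] by auto
        ultimately show ?thesis
          using U_sub[OF xy] fin by (simp add: card_Diff_subset card_insert_if numeral_2_eq_2)
      qed
      then show ?thesis by blast
    qed
  qed
qed (use fin in auto)

text \<open>When every relation outside \<open>E\<close> is a union of blocks between
  \<open>E\<close>-classes, numbering the classes and the points inside each class identifies the
  scheme with the wreath product of the trivial scheme on \<open>n\<close> points and the quotient
  on \<open>\<Omega> // E\<close>.\<close>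

lemma (in association_scheme) decomposable_if_saturated:
  assumes sym: "symmetric_scheme \<R>"
    and equiv: "equiv \<Omega> E" and R1: "R1 \<in> \<R>" "R1 \<noteq> Id_on \<Omega>" and E_eq: "E = Id_on \<Omega> \<union> R1"
    and card_E: "\<And>x. x \<in> \<Omega> \<Longrightarrow> card (E `` {x}) = n" and n: "n \<ge> 2" and E_ne: "E \<noteq> \<Omega> \<times> \<Omega>"
    and sat: "\<And>R x y x' y'. \<lbrakk>R \<in> \<R> - {Id_on \<Omega>, R1}; (x, y) \<in> R; (x, x') \<in> E; (y, y') \<in> E\<rbrakk> \<Longrightarrow> (x', y') \<in> R"
  shows "\<not> indecomposable \<Omega> \<R>"
proof -
  define q where "q = card (\<Omega> // E)"
  define \<Omega>1 where "\<Omega>1 = {0..<n}"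
  define \<Omega>2 where "\<Omega>2 = {0..<q}"
  have finE: "finite (\<Omega> // E)"
    using finite_points partition_on_quotient[OF equiv] finite_elements by blast
  have E_sub: "E `` {x} \<subseteq> \<Omega>" for x
    using equiv by (auto simp: equiv_def refl_on_def)
  have E_self: "x \<in> E `` {x}" if "x \<in> \<Omega>" for x
    using equiv that by (auto simp: equiv_def refl_on_def)
  obtain g where g: "bij_betw g (\<Omega> // E) \<Omega>2"
    using ex_bij_betw_finite_nat[OF finE] unfolding q_def \<Omega>2_def by blast
  have "\<forall>\<Delta>\<in>\<Omega> // E. \<exists>h. bij_betw h \<Delta> \<Omega>1"
  proof
    fix \<Delta> assume "\<Delta> \<in> \<Omega> // E"
    then obtain x where "x \<in> \<Omega>" "\<Delta> = E `` {x}" by (auto elim: quotientE)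
    then show "\<exists>h. bij_betw h \<Delta> \<Omega>1"
      using ex_bij_betw_finite_nat[of \<Delta>] finite_subset[OF E_sub finite_points] card_E
      unfolding \<Omega>1_def by auto
  qed
  then obtain h where h: "\<And>\<Delta>. \<Delta> \<in> \<Omega> // E \<Longrightarrow> bij_betw (h \<Delta>) \<Delta> \<Omega>1"
    by metis
  \<comment> \<open>\<open>b\<close> numbers the class of a point and \<open>c\<close> its position
    in the class. Arbitrary bijections will do: \<open>E\<close> consists of the diagonal and the
    single relation \<open>R1\<close>, so the scheme inside a class is invariant under all
    permutations.\<close>
  define b where "b x = g (E `` {x})" for x
  define c where "c x = h (E `` {x}) x" for x
  define H where "H x = (c x, b x)" for x
  have cls: "E `` {x} \<in> \<Omega> // E" if "x \<in> \<Omega>" for x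
    using that by (rule quotientI)
  have b_iff: "b x = b y \<longleftrightarrow> (x, y) \<in> E" if "x \<in> \<Omega>" "y \<in> \<Omega>" for x y
  proof -
    have "b x = b y \<longleftrightarrow> E `` {x} = E `` {y}"
      unfolding b_def using bij_betw_imp_inj_on[OF g] cls that by (auto dest: inj_onD)
    then show ?thesis
      using eq_equiv_class_iff[OF equiv that] by simp
  qed
  have b_in: "b x \<in> \<Omega>2" if "x \<in> \<Omega>" for x
    unfolding b_def using bij_betwE[OF g] cls[OF that] by blast
  have c_in: "c x \<in> \<Omega>1" if "x \<in> \<Omega>" for x
    unfolding c_def using bij_betwE[OF h[OF cls[OF that]]] E_self[OF that] by blast
  have surj: "\<exists>x\<in>\<Omega>. c x = a \<and> b x = u" if "a \<in> \<Omega>1" "u \<in> \<Omega>2" for a u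
  proof -
    obtain \<Delta> where \<Delta>: "\<Delta> \<in> \<Omega> // E" "g \<Delta> = u"
      using g \<open>u \<in> \<Omega>2\<close> by (metis bij_betw_imp_surj_on imageE)
    obtain x where x: "x \<in> \<Delta>" "h \<Delta> x = a"
      using h[OF \<Delta>(1)] \<open>a \<in> \<Omega>1\<close> by (metis bij_betw_imp_surj_on imageE)
    obtain y where y: "\<Delta> = E `` {y}"
      using \<Delta>(1) by (auto elim: quotientE)
    have "x \<in> \<Omega>" "E `` {x} = \<Delta>"
      using x(1) E_sub[of y] equiv_class_eq[OF equiv, of y x] by (auto simp: y)
    then show ?thesis
      using \<Delta> x by (auto simp: b_def c_def)
  qed
  have b_surj: "\<exists>x\<in>\<Omega>. b x = u" if "u \<in> \<Omega>2" for u
    using surj[of 0 u] that n by (auto simp: \<Omega>1_def)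
  have c_inj: "x = y" if "x \<in> \<Omega>" "y \<in> \<Omega>" "(x, y) \<in> E" "c x = c y" for x y
  proof -
    have "E `` {x} = E `` {y}"
      using eq_equiv_class_iff[OF equiv that(1,2)] that(3) by simp
    then show ?thesis
      using that E_self bij_betw_imp_inj_on[OF h[OF cls[OF that(1)]]] unfolding c_def
      by (auto dest: inj_onD)
  qed
  have H_bij: "bij_betw H \<Omega> (\<Omega>1 \<times> \<Omega>2)"
    unfolding bij_betw_def
  proof
    show "inj_on H \<Omega>"
      using b_iff c_inj by (auto simp: H_def intro!: inj_onI)
    show "H ` \<Omega> = \<Omega>1 \<times> \<Omega>2"
    proof
      show "H ` \<Omega> \<subseteq> \<Omega>1 \<times> \<Omega>2" using b_in c_in by (auto simp: H_def)
      show "\<Omega>1 \<times> \<Omega>2 \<subseteq> H ` \<Omega>" using surj by (force simp: H_def)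
    qed
  qed

  \<comment> \<open>\<open>img R\<close> is the quotient relation on class numbers and
    \<open>lift R\<close> its full preimage. \<open>R1\<close> is left out of \<open>\<R>2\<close>
    because its image is the diagonal again, and the preimage of that diagonal is
    \<open>E\<close>.\<close>
  define img where "img R = map_prod b b ` R" for R :: "'a rel"
  define lift where "lift R = (if R = Id_on \<Omega> then E else R)" for R :: "'a rel"
  define \<R>2 where "\<R>2 = img ` (\<R> - {R1})"
  have img_iff: "(b x, b y) \<in> img R \<longleftrightarrow> (x, y) \<in> lift R"
    if R: "R \<in> \<R> - {R1}" and xy: "x \<in> \<Omega>" "y \<in> \<Omega>" for R x y
  proof (cases "R = Id_on \<Omega>")
    case True
    have "(b x, b y) \<in> img R \<longleftrightarrow> b x = b y"
      using xy by (auto simp: True img_def)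
    then show ?thesis using b_iff xy True by (simp add: lift_def)
  next
    case False
    show ?thesis
    proof
      assume "(b x, b y) \<in> img R"
      then obtain x' y' where xy': "(x', y') \<in> R" "b x = b x'" "b y = b y'"
        by (auto simp: img_def)
      moreover have "x' \<in> \<Omega>" "y' \<in> \<Omega>"
        using rel_subset[of R] R xy' by auto
      ultimately have "(x', x) \<in> E" "(y', y) \<in> E"
        using b_iff xy by metis+
      then show "(x, y) \<in> lift R"
        using sat[of R x' y' x y] R False xy' by (auto simp: lift_def)
    next
      assume "(x, y) \<in> lift R"
      then show "(b x, b y) \<in> img R"
        using False by (auto simp: lift_def img_def)
    qed
  qed
  have lift_Union: "\<exists>\<A>\<subseteq>\<R>. lift R = \<Union>\<A>" if "R \<in> \<R>" for R
  proof (cases "R = Id_on \<Omega>")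
    case True
    then show ?thesis
      using that R1 E_eq by (intro exI[of _ "{Id_on \<Omega>, R1}"]) (auto simp: lift_def)
  next
    case False
    then show ?thesis
      using that by (intro exI[of _ "{R}"]) (auto simp: lift_def)
  qed
  have lift_unique: "R = Q"
    if "R \<in> \<R> - {R1}" "Q \<in> \<R> - {R1}" "p \<in> lift R" "p \<in> lift Q" for R Q p
    using that rel_unique[of R Q p] rel_unique[of R R1 p] rel_unique[of R1 Q p]
      rel_unique[of R "Id_on \<Omega>" p] rel_unique[of "Id_on \<Omega>" Q p] R1 diagonal
    by (auto simp: lift_def E_eq split: if_splits)
  have lift_exists: "\<exists>R\<in>\<R> - {R1}. (x, y) \<in> lift R" if xy: "x \<in> \<Omega>" "y \<in> \<Omega>" for x y
  proof -
    obtain R where R: "R \<in> \<R>" "(x, y) \<in> R"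
      using rel_exists[OF xy] by blast
    show ?thesis
    proof (cases "(x, y) \<in> E")
      case True
      then show ?thesis
        using diagonal R1 by (intro bexI[of _ "Id_on \<Omega>"]) (auto simp: lift_def)
    next
      case False
      then show ?thesis
        using R E_eq by (intro bexI[of _ R]) (auto simp: lift_def)
    qed
  qed
  have img_sub: "img R \<subseteq> \<Omega>2 \<times> \<Omega>2" if "R \<in> \<R>" for R
    using rel_subset[OF that] b_in by (auto simp: img_def)
  have img_Id: "img (Id_on \<Omega>) = Id_on \<Omega>2"
    using b_in b_surj by (fastforce simp: img_def)
  have img_inj: "R = Q"
    if RQ: "R \<in> \<R> - {R1}" "Q \<in> \<R> - {R1}" and p: "p \<in> img R" "p \<in> img Q" for R Q p
  proof -
    have "p \<in> \<Omega>2 \<times> \<Omega>2"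
      using img_sub RQ p by blast
    then obtain x y where "x \<in> \<Omega>" "y \<in> \<Omega>" "p = (b x, b y)"
      using b_surj by (metis mem_Sigma_iff prod.collapse)
    then show ?thesis
      using lift_unique[OF RQ] img_iff[OF RQ(1)] img_iff[OF RQ(2)] p by blast
  qed
  have sym': "R\<inverse> = R" if "R \<in> \<R>" for R
    using sym that by (simp add: symmetric_scheme_def)

  \<comment> \<open>Every class has \<open>n\<close> points, so a count of class numbers becomes a
    count of points after multiplication by \<open>n\<close>. This is how the intersection numbers
    are carried over to the quotient.\<close>
  have fibre: "card {z \<in> \<Omega>. b z \<in> V} = n * card V" if V: "V \<subseteq> \<Omega>2" for V
  proof -
    have finV: "finite V"
      using V finite_subset by (auto simp: \<Omega>2_def)
    have "{z \<in> \<Omega>. b z \<in> V} = (\<Union>u\<in>V. {z \<in> \<Omega>. b z = u})"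
      by auto
    also have "card \<dots> = (\<Sum>u\<in>V. card {z \<in> \<Omega>. b z = u})"
      using finV finite_points by (intro card_UN_disjoint) auto
    also have "\<dots> = (\<Sum>u\<in>V. n)"
    proof (intro sum.cong refl)
      fix u assume "u \<in> V"
      then obtain x where x: "x \<in> \<Omega>" "b x = u"
        using b_surj V by blast
      have "z \<in> \<Omega> \<and> b z = u \<longleftrightarrow> z \<in> E `` {x}" for z
        using b_iff[OF x(1), of z] E_sub[of x] x(2) by auto
      then have "{z \<in> \<Omega>. b z = u} = E `` {x}"
        by blast
      then show "card {z \<in> \<Omega>. b z = u} = n"
        using card_E x by simp
    qed
    finally show ?thesis by simp
  qed
  have scheme2: "association_scheme \<Omega>2 \<R>2"
  proof
    show "finite \<Omega>2" by (simp add: \<Omega>2_def)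
    show "Id_on \<Omega>2 \<in> \<R>2"
      using img_Id diagonal R1 unfolding \<R>2_def by (metis Diff_iff image_eqI singletonD)
    show "partition_on (\<Omega>2 \<times> \<Omega>2) \<R>2"
      unfolding partition_on_def
    proof (intro conjI)
      show "\<Union>\<R>2 = \<Omega>2 \<times> \<Omega>2"
      proof
        show "\<Union>\<R>2 \<subseteq> \<Omega>2 \<times> \<Omega>2"
          using img_sub by (auto simp: \<R>2_def)
        show "\<Omega>2 \<times> \<Omega>2 \<subseteq> \<Union>\<R>2"
        proof clarify
          fix u v assume "u \<in> \<Omega>2" "v \<in> \<Omega>2"
          then obtain x y where xy: "x \<in> \<Omega>" "y \<in> \<Omega>" "u = b x" "v = b y"
            using b_surj by metis
          then obtain R where "R \<in> \<R> - {R1}" "(x, y) \<in> lift R"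
            using lift_exists by blast
          then show "(u, v) \<in> \<Union>\<R>2"
            using img_iff xy unfolding \<R>2_def by blast
        qed
      qed
      show "disjoint \<R>2"
        unfolding \<R>2_def disjoint_def using img_inj by blast
      show "{} \<notin> \<R>2"
        using rel_nonempty by (auto simp: \<R>2_def img_def)
    qed
    show "R\<inverse> \<in> \<R>2" if R: "R \<in> \<R>2" for R
    proof -
      obtain R' where R': "R' \<in> \<R> - {R1}" "R = img R'"
        using R by (auto simp: \<R>2_def)
      have "R\<inverse> = img (R'\<inverse>)"
        unfolding R' img_def by force
      then show ?thesis using R R' sym' by simp
    qed
    show "\<exists>p. \<forall>(u, v)\<in>U. card {w \<in> \<Omega>2. (u, w) \<in> R \<and> (w, v) \<in> Q} = p"
      if "R \<in> \<R>2" "Q \<in> \<R>2" "U \<in> \<R>2" for R Q U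
    proof -
      obtain R' Q' U' where R': "R' \<in> \<R> - {R1}" "R = img R'" and Q': "Q' \<in> \<R> - {R1}" "Q = img Q'"
        and U': "U' \<in> \<R> - {R1}" "U = img U'"
        using \<open>R \<in> \<R>2\<close> \<open>Q \<in> \<R>2\<close> \<open>U \<in> \<R>2\<close> by (auto simp: \<R>2_def)
      obtain \<A> where A: "\<A> \<subseteq> \<R>" "lift R' = \<Union>\<A>"
        using lift_Union[of R'] R'(1) by auto
      obtain \<B> where B: "\<B> \<subseteq> \<R>" "lift Q' = \<Union>\<B>"
        using lift_Union[of Q'] Q'(1) by auto
      have count: "n * card {w \<in> \<Omega>2. (u, w) \<in> R \<and> (w, v) \<in> Q} = (\<Sum>(A, B)\<in>\<A> \<times> \<B>. intersection_number \<Omega> A B U')"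
        if uv: "(u, v) \<in> U" for u v
      proof -
        obtain x y where xy: "(x, y) \<in> U'" "u = b x" "v = b y"
          using uv U' by (auto simp: img_def)
        have xy\<Omega>: "x \<in> \<Omega>" "y \<in> \<Omega>"
          using rel_subset[of U'] U' xy by auto
        have "n * card {w \<in> \<Omega>2. (u, w) \<in> R \<and> (w, v) \<in> Q} = card {z \<in> \<Omega>. b z \<in> {w \<in> \<Omega>2. (u, w) \<in> R \<and> (w, v) \<in> Q}}"
          by (rule fibre[symmetric]) auto
        also have "{z \<in> \<Omega>. b z \<in> {w \<in> \<Omega>2. (u, w) \<in> R \<and> (w, v) \<in> Q}} = {z \<in> \<Omega>. (x, z) \<in> \<Union>\<A> \<and> (z, y) \<in> \<Union>\<B>}"
          unfolding A(2)[symmetric] B(2)[symmetric] R'(2) Q'(2) xy(2,3)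
          using img_iff[OF R'(1) xy\<Omega>(1)] img_iff[OF Q'(1) _ xy\<Omega>(2)] b_in by auto
        also have "card \<dots> = (\<Sum>(A, B)\<in>\<A> \<times> \<B>. intersection_number \<Omega> A B U')"
          using card_paths_Union[OF A(1) B(1)] U' xy by blast
        finally show ?thesis .
      qed
      have "card {w \<in> \<Omega>2. (u, w) \<in> R \<and> (w, v) \<in> Q} = (\<Sum>(A, B)\<in>\<A> \<times> \<B>. intersection_number \<Omega> A B U') div n"
        if "(u, v) \<in> U" for u v
        unfolding count[OF that, symmetric] using n by simp
      then show ?thesis by blast
    qed
  qed

  define W1 where "W1 R = {((a, u), (b, u)) | a b u. (a, b) \<in> R \<and> u \<in> \<Omega>2}" for R :: "nat rel"
  define W2 where "W2 R = {((a, u), (b, v)) | a b u v. a \<in> \<Omega>1 \<and> b \<in> \<Omega>1 \<and> (u, v) \<in> R}" for R :: "nat rel"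
  define \<R>1 where "\<R>1 = {Id_on \<Omega>1, \<Omega>1 \<times> \<Omega>1 - Id_on \<Omega>1}"
  have wreath: "wreath_product \<Omega>1 \<R>1 \<Omega>2 \<R>2 = W1 ` \<R>1 \<union> W2 ` (\<R>2 - {Id_on \<Omega>2})"
    unfolding wreath_product_def W1_def W2_def ..
  have R1_iff: "(x, y) \<in> R1 \<longleftrightarrow> (x, y) \<in> E \<and> x \<noteq> y" if "x \<in> \<Omega>" for x y
    using rel_unique[OF R1(1) diagonal] R1(2) that unfolding E_eq by auto
  have h1: "map_prod H H ` Id_on \<Omega> = W1 (Id_on \<Omega>1)"
  proof
    show "map_prod H H ` Id_on \<Omega> \<subseteq> W1 (Id_on \<Omega>1)"
      using b_in c_in by (auto simp: W1_def H_def)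
    show "W1 (Id_on \<Omega>1) \<subseteq> map_prod H H ` Id_on \<Omega>"
    proof
      fix p assume "p \<in> W1 (Id_on \<Omega>1)"
      then obtain a u where "p = ((a, u), (a, u))" "a \<in> \<Omega>1" "u \<in> \<Omega>2"
        by (auto simp: W1_def)
      then show "p \<in> map_prod H H ` Id_on \<Omega>"
        using surj[of a u] by (force simp: H_def)
    qed
  qed
  have h2: "map_prod H H ` R1 = W1 (\<Omega>1 \<times> \<Omega>1 - Id_on \<Omega>1)"
  proof
    show "map_prod H H ` R1 \<subseteq> W1 (\<Omega>1 \<times> \<Omega>1 - Id_on \<Omega>1)"
    proof
      fix p assume "p \<in> map_prod H H ` R1"
      then obtain x y where xy: "(x, y) \<in> R1" "p = (H x, H y)"
        by auto
      have xy\<Omega>: "x \<in> \<Omega>" "y \<in> \<Omega>"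
        using rel_subset[OF R1(1)] xy by auto
      then have "b y = b x" "c x \<noteq> c y"
        using R1_iff[of x y] b_iff[of x y] c_inj[of x y] xy(1) by auto
      then show "p \<in> W1 (\<Omega>1 \<times> \<Omega>1 - Id_on \<Omega>1)"
        using xy(2) xy\<Omega> b_in c_in by (auto simp: W1_def H_def)
    qed
    show "W1 (\<Omega>1 \<times> \<Omega>1 - Id_on \<Omega>1) \<subseteq> map_prod H H ` R1"
    proof
      fix p assume "p \<in> W1 (\<Omega>1 \<times> \<Omega>1 - Id_on \<Omega>1)"
      then obtain a a' u where p: "p = ((a, u), (a', u))" "a \<in> \<Omega>1" "a' \<in> \<Omega>1" "a \<noteq> a'" "u \<in> \<Omega>2"
        by (auto simp: W1_def)
      obtain x y where xy: "x \<in> \<Omega>" "c x = a" "b x = u" "y \<in> \<Omega>" "c y = a'" "b y = u"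
        using surj p by metis
      then have "(x, y) \<in> R1"
        using R1_iff[of x y] b_iff[of x y] p(4) by auto
      then show "p \<in> map_prod H H ` R1"
        using p xy by (force simp: H_def)
    qed
  qed
  have h3: "map_prod H H ` R = W2 (img R)" if R: "R \<in> \<R> - {R1, Id_on \<Omega>}" for R
  proof
    show "map_prod H H ` R \<subseteq> W2 (img R)"
    proof
      fix p assume "p \<in> map_prod H H ` R"
      then obtain x y where xy: "(x, y) \<in> R" "p = (H x, H y)"
        by auto
      moreover have "x \<in> \<Omega>" "y \<in> \<Omega>"
        using rel_subset[of R] R xy by auto
      ultimately show "p \<in> W2 (img R)"
        using c_in by (auto simp: W2_def H_def img_def)
    qed
    show "W2 (img R) \<subseteq> map_prod H H ` R"
    proof
      fix p assume "p \<in> W2 (img R)"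
      then obtain a u a' v where p: "p = ((a, u), (a', v))" "a \<in> \<Omega>1" "a' \<in> \<Omega>1" "(u, v) \<in> img R"
        by (auto simp: W2_def)
      then have "u \<in> \<Omega>2" "v \<in> \<Omega>2"
        using img_sub R by blast+
      then obtain x y where xy: "x \<in> \<Omega>" "c x = a" "b x = u" "y \<in> \<Omega>" "c y = a'" "b y = v"
        using surj p by metis
      then have "(x, y) \<in> R"
        using img_iff[of R x y] R p by (auto simp: lift_def)
      then show "p \<in> map_prod H H ` R"
        using p xy by (force simp: H_def)
    qed
  qed
  have "(\<lambda>R. map_prod H H ` R) ` \<R> = wreath_product \<Omega>1 \<R>1 \<Omega>2 \<R>2"
  proof -
    have R2_eq: "\<R>2 - {Id_on \<Omega>2} = img ` (\<R> - {R1, Id_on \<Omega>})"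
    proof -
      have "img R \<noteq> Id_on \<Omega>2" if R: "R \<in> \<R> - {R1, Id_on \<Omega>}" for R
      proof
        assume eq: "img R = Id_on \<Omega>2"
        have "img R \<noteq> {}"
          using rel_nonempty[of R] R by (simp add: img_def)
        then show False
          using img_inj[of R "Id_on \<Omega>"] R eq img_Id diagonal R1 by auto
      qed
      then show ?thesis
        using img_Id by (auto simp: \<R>2_def)
    qed
    have R_eq: "h ` \<R> = {h (Id_on \<Omega>), h R1} \<union> h ` (\<R> - {R1, Id_on \<Omega>})" 
        for h :: "'a rel \<Rightarrow> (nat \<times> nat) rel"
      using diagonal R1 by blast
    have "(\<lambda>R. map_prod H H ` R) ` (\<R> - {R1, Id_on \<Omega>}) = W2 ` img ` (\<R> - {R1, Id_on \<Omega>})"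
      unfolding image_image using h3 by (intro image_cong refl)
    then show ?thesis
      unfolding wreath unfolding \<R>1_def R2_eq R_eq h1 h2 by simp
  qed
  then have iso: "scheme_iso \<Omega> \<R> (\<Omega>1 \<times> \<Omega>2) (wreath_product \<Omega>1 \<R>1 \<Omega>2 \<R>2)"
    unfolding scheme_iso_def using H_bij by blast
  have "card \<Omega>2 \<ge> 2"
  proof -
    have "\<exists>x\<in>\<Omega>. \<exists>y\<in>\<Omega>. (x, y) \<notin> E"
      using E_ne equiv by (auto simp: equiv_def refl_on_def)
    then obtain x y where xy: "x \<in> \<Omega>" "y \<in> \<Omega>" "b x \<noteq> b y"
      using b_iff by blast
    then have "card {b x, b y} \<le> card \<Omega>2"
      using b_in[OF xy(1)] b_in[OF xy(2)] by (intro card_mono) (auto simp: \<Omega>2_def)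
    then show ?thesis
      using xy(3) by simp
  qed
  moreover have "association_scheme \<Omega>1 \<R>1"
    unfolding \<R>1_def using n by (intro trivial_scheme) (auto simp: \<Omega>1_def)
  moreover have "card \<Omega>1 \<ge> 2"
    using n by (simp add: \<Omega>1_def)
  ultimately show ?thesis
    unfolding indecomposable_def using scheme2 iso by blast
qed

section \<open>Schemes with two nested parabolics\<close>

text \<open>Indecomposability enters as \<open>card_S_E\<close> with \<open>0 < r < n\<close>: as
  seen from any point, \<open>S\<close> and \<open>T\<close> both meet each \<open>E\<close>-class
  outside its \<open>F\<close>-class, and in constant numbers. In the parameters,
  \<open>k = m r\<close>.\<close>

locale two_level_scheme = association_scheme \<Omega> \<R> for \<Omega> :: "'a set" and \<R> +
  fixes E F R1 R2 S T :: "'a rel" and f m n r :: nat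
  assumes symmetric: "symmetric_scheme \<R>"
    and rels: "\<R> = {Id_on \<Omega>, R1, R2, S, T}"
    and E_eq: "E = Id_on \<Omega> \<union> R1" and F_eq: "F = E \<union> R2"
    and equiv_E: "equiv \<Omega> E" and equiv_F: "equiv \<Omega> F"
    and R2_E: "R2 \<inter> E = {}" and R1_Id: "R1 \<inter> Id_on \<Omega> = {}"
    and S_F: "S \<inter> F = {}" and T_F: "T \<inter> F = {}" and S_T: "S \<inter> T = {}"
    and card_E: "x \<in> \<Omega> \<Longrightarrow> card (E `` {x}) = n"
    and card_F: "x \<in> \<Omega> \<Longrightarrow> card (F `` {x}) = m * n"
    and card_quotient: "card (\<Omega> // F) = f"
    and card_S_E: "x \<in> \<Omega> \<Longrightarrow> y \<in> \<Omega> \<Longrightarrow> (x, y) \<notin> F \<Longrightarrow> card (S `` {x} \<inter> E `` {y}) = r"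
    and r_pos: "0 < r" and r_less: "r < n" and m_pos: "0 < m" and f_ge: "2 \<le> f"
begin

definition C :: "'a \<Rightarrow> 'a \<Rightarrow> real" where
  "C x y = (if (x, y) \<in> F then 0 else of_bool ((x, y) \<in> S) - real r / real n)"

definition P :: "'a \<Rightarrow> 'a \<Rightarrow> real" where
  "P x y = of_bool (x = y) - of_bool ((x, y) \<in> E) / real n"

text \<open>With \<open>k = m r\<close> this is \<open>k (m n - k) / (m (n - 1))\<close>. The value
  makes \<open>(f - 1) D P\<close> agree with \<open>C\<^sup>2\<close> on the diagonal.\<close>

definition D :: real where
  "D = real m * real r * (real n - real r) / (real n - 1)"

section \<open>The five relations and the two equivalences\<close>

lemma rels_mem: "Id_on \<Omega> \<in> \<R>" "R1 \<in> \<R>" "R2 \<in> \<R>" "S \<in> \<R>" "T \<in> \<R>"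
  using rels by auto

lemma sym_rel: "R \<in> \<R> \<Longrightarrow> (x, y) \<in> R \<longleftrightarrow> (y, x) \<in> R"
  using symmetric unfolding symmetric_scheme_def by blast

lemma E_sym: "(x, y) \<in> E \<longleftrightarrow> (y, x) \<in> E"
  using equiv_E by (meson equivE symE)

lemma F_sym: "(x, y) \<in> F \<longleftrightarrow> (y, x) \<in> F"
  using equiv_F by (meson equivE symE)

lemma E_sub_F: "E \<subseteq> F"
  using F_eq by auto

lemma E_\<Omega>: "(x, y) \<in> E \<Longrightarrow> x \<in> \<Omega> \<and> y \<in> \<Omega>"
  using equiv_E by (auto simp: equiv_def refl_on_def)

lemma F_\<Omega>: "(x, y) \<in> F \<Longrightarrow> x \<in> \<Omega> \<and> y \<in> \<Omega>"
  using equiv_F by (auto simp: equiv_def refl_on_def)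

lemma E_refl: "x \<in> \<Omega> \<Longrightarrow> (x, x) \<in> E"
  using equiv_E by (auto simp: equiv_def refl_on_def)

lemma F_refl: "x \<in> \<Omega> \<Longrightarrow> (x, x) \<in> F"
  using equiv_F by (auto simp: equiv_def refl_on_def)

lemma F_trans: "(x, y) \<in> F \<Longrightarrow> (y, z) \<in> F \<Longrightarrow> (x, z) \<in> F"
  using equiv_F by (meson equivE transE)

lemma E_trans: "(x, y) \<in> E \<Longrightarrow> (y, z) \<in> E \<Longrightarrow> (x, z) \<in> E"
  using equiv_E by (meson equivE transE)

lemma F_cong: "(y, z) \<in> F \<Longrightarrow> (x, y) \<in> F \<longleftrightarrow> (x, z) \<in> F"
  using F_trans F_sym by blast

lemma E_cong: "(x, y) \<in> E \<Longrightarrow> (y, z) \<in> E \<longleftrightarrow> (x, z) \<in> E"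
  using E_trans E_sym by blast

lemma not_F: "x \<in> \<Omega> \<Longrightarrow> y \<in> \<Omega> \<Longrightarrow> (x, y) \<notin> F \<longleftrightarrow> (x, y) \<in> S \<or> (x, y) \<in> T"
  using rel_exists[of x y] S_F T_F unfolding rels F_eq E_eq by auto

lemma T_iff: "x \<in> \<Omega> \<Longrightarrow> y \<in> \<Omega> \<Longrightarrow> (x, y) \<in> T \<longleftrightarrow> (x, y) \<notin> F \<and> (x, y) \<notin> S"
  using not_F S_T T_F by blast

lemma finite_class: "finite (E `` {x})" "finite (F `` {x})"
  using finite_points E_\<Omega> F_\<Omega> by (auto intro: finite_subset[of _ \<Omega>])

lemma n_pos: "0 < n"
  using r_less by simp

section \<open>The matrices \<open>C\<close> and \<open>P\<close> and sums over classes\<close>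

lemma C_sym: "C x y = C y x"
  using sym_rel[OF rels_mem(4), of x y] F_sym[of x y] by (simp add: C_def)

lemma P_sym: "P x y = P y x"
  using E_sym[of x y] by (auto simp: P_def)

lemma C_F: "(x, y) \<in> F \<Longrightarrow> C x y = 0"
  by (simp add: C_def)

lemma P_F: "x \<in> \<Omega> \<Longrightarrow> (x, y) \<notin> F \<Longrightarrow> P x y = 0"
  using E_sub_F F_refl by (auto simp: P_def)

lemma class_eq: "\<Gamma> \<in> \<Omega> // F \<Longrightarrow> x \<in> \<Gamma> \<Longrightarrow> \<Gamma> = F `` {x}"
  using equiv_class_eq[OF equiv_F] by (auto elim!: quotientE)

lemma class_sub: "\<Gamma> \<in> \<Omega> // F \<Longrightarrow> \<Gamma> \<subseteq> \<Omega>"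
  using equiv_F by (meson in_quotient_imp_subset)

text \<open>Outside the \<open>F\<close>-class of \<open>x\<close>, exactly \<open>r\<close> of the
  \<open>n\<close> points are in \<open>S\<close>, which the subtracted mean \<open>r / n\<close>
  balances. In matrix terms, \<open>C\<close> kills the functions constant on
  \<open>E\<close>-classes; hence \<open>P C = C\<close>.\<close>

lemma C_sum_E:
  assumes "x \<in> \<Omega>" "y \<in> \<Omega>"
  shows "(\<Sum>z\<in>E `` {y}. C x z) = 0"
proof (cases "(x, y) \<in> F")
  case True
  then show ?thesis
    using E_sub_F F_trans by (intro sum.neutral) (auto simp: C_def)
next
  case False
  have "(\<Sum>z\<in>E `` {y}. C x z) = (\<Sum>z\<in>E `` {y}. of_bool ((x, z) \<in> S) - real r / real n)"
    using False E_sub_F F_cong[of y] by (intro sum.cong) (auto simp: C_def)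
  also have "\<dots> = real (card (E `` {y} \<inter> {z. (x, z) \<in> S})) - real n * (real r / real n)"
    using finite_class by (simp add: sum_subtractf card_E assms)
  also have "E `` {y} \<inter> {z. (x, z) \<in> S} = S `` {x} \<inter> E `` {y}"
    by auto
  finally show ?thesis
    using card_S_E[OF assms False] n_pos by simp
qed

text \<open>Double counting: each \<open>w\<close> lies in the \<open>E\<close>-class of exactly
  \<open>n\<close> points \<open>z\<close>. Sums over an \<open>F\<close>-class thus reduce to sums
  over \<open>E\<close>-classes without a choice of representatives.\<close>

lemma sum_E_classes:
  fixes g :: "'a \<Rightarrow> real"
  assumes "y \<in> \<Omega>"
  shows "(\<Sum>z\<in>F `` {y}. \<Sum>w\<in>E `` {z}. g w) = real n * (\<Sum>w\<in>F `` {y}. g w)"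
proof -
  have "(\<Sum>z\<in>F `` {y}. \<Sum>w\<in>E `` {z}. g w) = (\<Sum>z\<in>F `` {y}. \<Sum>w\<in>F `` {y}. if (w, z) \<in> E then g w else 0)"
  proof (rule sum.cong[OF refl])
    fix z assume z: "z \<in> F `` {y}"
    have "E `` {z} = {w \<in> F `` {y}. (w, z) \<in> E}"
      using z E_sub_F F_trans E_sym by blast
    then show "(\<Sum>w\<in>E `` {z}. g w) = (\<Sum>w\<in>F `` {y}. if (w, z) \<in> E then g w else 0)"
      by (simp only: sum.inter_filter[OF finite_class(2)])
  qed
  also have "\<dots> = (\<Sum>w\<in>F `` {y}. \<Sum>z\<in>F `` {y}. if (w, z) \<in> E then g w else 0)"
    by (rule sum.swap)
  also have "\<dots> = (\<Sum>w\<in>F `` {y}. real n * g w)"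
  proof (intro sum.cong refl)
    fix w assume w: "w \<in> F `` {y}"
    have "(\<Sum>z\<in>F `` {y}. if (w, z) \<in> E then g w else 0) = (\<Sum>z\<in>{z \<in> F `` {y}. (w, z) \<in> E}. g w)"
      by (simp only: sum.inter_filter[OF finite_class(2)])
    also have "{z \<in> F `` {y}. (w, z) \<in> E} = E `` {w}"
      using w E_sub_F F_trans by blast
    finally show "(\<Sum>z\<in>F `` {y}. if (w, z) \<in> E then g w else 0) = real n * g w"
      using w F_\<Omega> by (simp add: card_E)
  qed
  finally show ?thesis by (simp add: sum_distrib_left)
qed

lemma C_sum_F:
  assumes "x \<in> \<Omega>" "y \<in> \<Omega>"
  shows "(\<Sum>z\<in>F `` {y}. C x z) = 0"
proof -
  have "(\<Sum>z\<in>F `` {y}. \<Sum>w\<in>E `` {z}. C x w) = 0"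
    using C_sum_E assms F_\<Omega> by (intro sum.neutral) auto
  then show ?thesis
    using sum_E_classes[OF assms(2)] n_pos by simp
qed

lemma partition_F: "partition_on \<Omega> (\<Omega> // F)"
  using equiv_F by (rule partition_on_quotient)

lemma sum_classes:
  fixes g :: "'a \<Rightarrow> real"
  shows "(\<Sum>z\<in>\<Omega>. g z) = (\<Sum>\<Gamma>\<in>\<Omega> // F. \<Sum>z\<in>\<Gamma>. g z)"
proof -
  have "(\<Sum>z\<in>\<Union>(\<Omega> // F). g z) = (\<Sum>\<Gamma>\<in>\<Omega> // F. \<Sum>z\<in>\<Gamma>. g z)"
    using partition_F finite_subset[OF class_sub finite_points]
    by (subst sum.Union_disjoint) (auto simp: partition_on_def disjoint_def)
  then show ?thesis
    using partition_F by (simp add: partition_on_def)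
qed

lemma class_rep: "\<Gamma> \<in> \<Omega> // F \<Longrightarrow> \<exists>y\<in>\<Omega>. \<Gamma> = F `` {y}"
  by (auto elim: quotientE)

lemma C_sum:
  assumes "x \<in> \<Omega>"
  shows "(\<Sum>z\<in>\<Omega>. C x z) = 0"
  unfolding sum_classes
proof (rule sum.neutral, rule ballI)
  fix \<Gamma> assume "\<Gamma> \<in> \<Omega> // F"
  then obtain y where "y \<in> \<Omega>" "\<Gamma> = F `` {y}"
    using class_rep by blast
  then show "(\<Sum>z\<in>\<Gamma>. C x z) = 0"
    using C_sum_F assms by simp
qed

lemma card_points: "real (card \<Omega>) = real f * (real m * real n)"
proof -
  have "real (card \<Omega>) = (\<Sum>\<Gamma>\<in>\<Omega> // F. \<Sum>z\<in>\<Gamma>. 1)"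
    using sum_classes[of "\<lambda>_. 1"] by simp
  also have "\<dots> = (\<Sum>\<Gamma>\<in>\<Omega> // F. real m * real n)"
  proof (intro sum.cong refl)
    fix \<Gamma> assume "\<Gamma> \<in> \<Omega> // F"
    then show "(\<Sum>z\<in>\<Gamma>. 1) = real m * real n"
      using class_rep[of \<Gamma>] card_F by auto
  qed
  finally show ?thesis by (simp add: card_quotient)
qed

text \<open>The vanishing sum of \<open>C\<close> over an \<open>F\<close>-class, translated back
  into a count; this count is the parameter \<open>k\<close>.\<close>

lemma card_S_F:
  assumes "x \<in> \<Omega>" "y \<in> \<Omega>" "(x, y) \<notin> F"
  shows "card (S `` {x} \<inter> F `` {y}) = m * r"
proof -
  have "0 = (\<Sum>z\<in>F `` {y}. C x z)"
    using C_sum_F assms by simp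
  also have "\<dots> = (\<Sum>z\<in>F `` {y}. of_bool ((x, z) \<in> S) - real r / real n)"
    using assms F_cong[of y] by (intro sum.cong) (auto simp: C_def)
  also have "\<dots> = real (card (F `` {y} \<inter> {z. (x, z) \<in> S})) - real m * real r"
    using finite_class n_pos by (simp add: sum_subtractf card_F assms)
  also have "F `` {y} \<inter> {z. (x, z) \<in> S} = S `` {x} \<inter> F `` {y}"
    by auto
  finally show ?thesis
    by (metis eq_iff_diff_eq_0 of_nat_eq_iff of_nat_mult)
qed

lemma sum_not_F:
  fixes g :: "'a \<Rightarrow> real"
  assumes "x \<in> \<Omega>"
  shows "(\<Sum>z\<in>\<Omega>. if (x, z) \<in> F then 0 else g z) = (\<Sum>z\<in>\<Omega>. g z) - (\<Sum>z\<in>F `` {x}. g z)"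
proof -
  have "(\<Sum>z\<in>\<Omega>. if (x, z) \<in> F then 0 else g z) = (\<Sum>z\<in>\<Omega>. g z - (if z \<in> F `` {x} then g z else 0))"
    by (intro sum.cong) auto
  also have "\<dots> = (\<Sum>z\<in>\<Omega>. g z) - (\<Sum>z\<in>{z\<in>\<Omega>. z \<in> F `` {x}}. g z)"
    using finite_points by (simp only: sum_subtractf sum.inter_filter)
  also have "{z\<in>\<Omega>. z \<in> F `` {x}} = F `` {x}"
    using F_\<Omega> by auto
  finally show ?thesis .
qed

lemma card_S:
  assumes "x \<in> \<Omega>"
  shows "real (card (S `` {x})) = (real f - 1) * (real m * real r)"
proof -
  have "0 = (\<Sum>z\<in>\<Omega>. C x z)"
    using C_sum assms by simp
  also have "\<dots> = (\<Sum>z\<in>\<Omega>. of_bool ((x, z) \<in> S)) - (\<Sum>z\<in>\<Omega>. if (x, z) \<in> F then 0 else real r / real n)"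
    unfolding sum_subtractf[symmetric] using S_F by (intro sum.cong) (auto simp: C_def)
  also have "\<dots> = real (card (\<Omega> \<inter> {z. (x, z) \<in> S})) - (real f - 1) * (real m * real r)"
    using finite_points n_pos
    by (simp add: sum_not_F assms card_F card_points field_simps)
  also have "\<Omega> \<inter> {z. (x, z) \<in> S} = S `` {x}"
    using rel_subset[OF rels_mem(4)] by auto
  finally show ?thesis by simp
qed

text \<open>\<open>P\<close> subtracts the mean over the \<open>E\<close>-class. Since
  \<open>P\<close> vanishes off \<open>F\<close>, a sum over the \<open>F\<close>-class is the whole
  matrix product, and it is also the form needed for diagonal blocks.\<close>

lemma P_mult:
  fixes g :: "'a \<Rightarrow> real"
  assumes "x \<in> \<Omega>"
  shows "(\<Sum>z\<in>F `` {x}. P x z * g z) = g x - (\<Sum>z\<in>E `` {x}. g z) / real n"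
proof -
  have "(\<Sum>z\<in>F `` {x}. P x z * g z) =
      (\<Sum>z\<in>F `` {x}. if z = x then g z else 0) - (\<Sum>z\<in>F `` {x}. if z \<in> E `` {x} then g z / real n else 0)"
    unfolding sum_subtractf[symmetric] by (intro sum.cong) (auto simp: P_def algebra_simps)
  also have "(\<Sum>z\<in>F `` {x}. if z = x then g z else 0) = g x"
    using finite_class F_refl[OF assms] by simp
  also have "(\<Sum>z\<in>F `` {x}. if z \<in> E `` {x} then g z / real n else 0) =
      (\<Sum>z\<in>{z \<in> F `` {x}. z \<in> E `` {x}}. g z / real n)"
    using finite_class by (simp only: sum.inter_filter)
  also have "{z \<in> F `` {x}. z \<in> E `` {x}} = E `` {x}"
    using E_sub_F by auto
  finally show ?thesis by (simp add: sum_divide_distrib)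
qed

lemma P_C:
  assumes "x \<in> \<Omega>" "y \<in> \<Omega>"
  shows "(\<Sum>z\<in>F `` {x}. P x z * C z y) = C x y"
proof -
  have "(\<Sum>z\<in>E `` {x}. C z y) = 0"
    using C_sum_E[OF assms(2,1)] by (simp only: C_sym[of _ y])
  then show ?thesis by (simp add: P_mult assms)
qed

lemma P_P:
  assumes "x \<in> \<Omega>" "y \<in> \<Omega>"
  shows "(\<Sum>z\<in>F `` {x}. P x z * P z y) = P x y"
proof -
  have "(\<Sum>z\<in>E `` {x}. P z y) = (\<Sum>z\<in>E `` {x}. of_bool (z = y)) - (\<Sum>z\<in>E `` {x}. of_bool ((x, y) \<in> E) / real n)"
    unfolding sum_subtractf[symmetric] using E_cong[of x]
    by (intro sum.cong refl) (auto simp: P_def)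
  also have "(\<Sum>z\<in>E `` {x}. of_bool (z = y)) = (of_bool ((x, y) \<in> E) :: real)"
    using finite_class by (auto simp: of_bool_def)
  finally have "(\<Sum>z\<in>E `` {x}. P z y) = 0"
    using n_pos by (simp add: card_E assms)
  then show ?thesis by (simp add: P_mult assms)
qed

section \<open>The square of \<open>C\<close>\<close>

definition CC :: "'a \<Rightarrow> 'a \<Rightarrow> real" where
  "CC x y = (\<Sum>z\<in>\<Omega>. C x z * C z y)"

text \<open>With \<open>q = r / n\<close>, \<open>C\<close> is \<open>1 - q\<close> times the
  adjacency matrix of \<open>S\<close> minus \<open>q\<close> times that of \<open>T\<close>. Its
  square is therefore a combination of products of adjacency matrices, whose entries are
  intersection numbers.\<close>

lemma CC_const:
  assumes "R \<in> \<R>" "(x, y) \<in> R" "(x', y') \<in> R"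
  shows "CC x y = CC x' y'"
proof -
  define q where "q = real r / real n"
  define N where "N A B u v = real (card {z \<in> \<Omega>. (u, z) \<in> A \<and> (z, v) \<in> B})" for A B :: "'a rel" and u v
  have N: "(\<Sum>z\<in>\<Omega>. of_bool ((u, z) \<in> A \<and> (z, v) \<in> B)) = N A B u v" for A B u v
    using finite_points by (simp add: N_def Int_def)
  have "CC u v = (1 - q)\<^sup>2 * N S S u v - q * (1 - q) * N S T u v - q * (1 - q) * N T S u v + q\<^sup>2 * N T T u v"
    if "u \<in> \<Omega>" "v \<in> \<Omega>" for u v
  proof -
    have C: "C a b = (1 - q) * of_bool ((a, b) \<in> S) - q * of_bool ((a, b) \<in> T)" if "a \<in> \<Omega>" "b \<in> \<Omega>" for a b
      using that not_F[of a b] T_iff[of a b] by (auto simp: C_def q_def)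
    have "CC u v = (\<Sum>z\<in>\<Omega>. (1 - q)\<^sup>2 * of_bool ((u, z) \<in> S \<and> (z, v) \<in> S)
        - q * (1 - q) * of_bool ((u, z) \<in> S \<and> (z, v) \<in> T)
        - q * (1 - q) * of_bool ((u, z) \<in> T \<and> (z, v) \<in> S) + q\<^sup>2 * of_bool ((u, z) \<in> T \<and> (z, v) \<in> T))"
      unfolding CC_def using that by (intro sum.cong refl) (auto simp: C algebra_simps power2_eq_square)
    then show ?thesis
      by (simp only: sum.distrib sum_subtractf sum_distrib_left[symmetric] N)
  qed
  moreover have "N A B x y = N A B x' y'" if "A \<in> \<R>" "B \<in> \<R>" for A B
    unfolding N_def card_paths[OF that assms(1,2)] card_paths[OF that assms(1,3)] ..
  moreover have "x \<in> \<Omega>" "y \<in> \<Omega>" "x' \<in> \<Omega>" "y' \<in> \<Omega>"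
    using rel_subset[OF assms(1)] assms(2,3) by auto
  ultimately show ?thesis
    using rels_mem by simp
qed

lemma CC_sum_E:
  assumes "x \<in> \<Omega>" "y \<in> \<Omega>"
  shows "(\<Sum>w\<in>E `` {y}. CC x w) = 0"
proof -
  have "(\<Sum>w\<in>E `` {y}. CC x w) = (\<Sum>z\<in>\<Omega>. C x z * (\<Sum>w\<in>E `` {y}. C z w))"
    unfolding CC_def by (subst sum.swap) (simp add: sum_distrib_left)
  then show ?thesis
    using C_sum_E assms by simp
qed

lemma CC_diag:
  assumes "x \<in> \<Omega>"
  shows "CC x x = (real f - 1) * (real m * real r * (real n - real r) / real n)"
proof -
  define q where "q = real r / real n"
  \<comment> \<open>Off \<open>F\<close> the entries of \<open>C\<close> are \<open>1 - q\<close>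
    and \<open>- q\<close>, the two roots of \<open>c\<^sup>2 = (1 - 2 q) c + q (1 - q)\<close>; the
    linear part has row sum 0.\<close>
  have "CC x x = (\<Sum>z\<in>\<Omega>. (1 - 2 * q) * C x z + (if (x, z) \<in> F then 0 else q * (1 - q)))"
    unfolding CC_def
    by (intro sum.cong refl) (simp add: C_sym[of _ x], auto simp: C_def q_def algebra_simps)
  also have "\<dots> = (1 - 2 * q) * (\<Sum>z\<in>\<Omega>. C x z) + (real f - 1) * (real m * real n) * (q * (1 - q))"
    unfolding sum.distrib sum_distrib_left
    by (simp add: sum_not_F assms card_F card_points algebra_simps)
  also have "\<dots> = (real f - 1) * (real m * real r * (real n - real r) / real n)"
    using n_pos by (simp add: C_sum assms q_def field_simps)
  finally show ?thesis .
qed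

text \<open>\<open>CC\<close> is constant on each basic relation and sums to 0 over every
  \<open>E\<close>-class. So the diagonal value is cancelled by \<open>n - 1\<close> equal entries
  on \<open>R1\<close>, and on \<open>R2\<close> the value is 0, because there a whole
  \<open>E\<close>-class lies in \<open>R2\<close> as seen from \<open>x\<close>.\<close>

lemma CC_F:
  assumes "(x, y) \<in> F"
  shows "CC x y = (real f - 1) * D * P x y"
proof -
  have x: "x \<in> \<Omega>" and y: "y \<in> \<Omega>"
    using F_\<Omega> assms by auto
  have n1: "real n - 1 > 0"
    using r_pos r_less by simp
  consider "x = y" | "(x, y) \<in> R1" | "(x, y) \<in> R2"
    using assms F_eq E_eq by auto
  then show ?thesis
  proof cases
    case 1
    have "P x x = (real n - 1) / real n"
      using n_pos E_refl[OF x] by (simp add: P_def field_simps)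
    then show ?thesis
      using 1 n1 CC_diag[OF x] by (simp add: D_def)
  next
    case 2
    have neq: "x \<noteq> y"
      using 2 R1_Id x by auto
    have xE: "(x, y) \<in> E"
      using 2 E_eq by auto
    have "0 = (\<Sum>w\<in>E `` {x}. CC x w)"
      using CC_sum_E x by simp
    also have "\<dots> = CC x x + (\<Sum>w\<in>E `` {x} - {x}. CC x w)"
      using E_refl x finite_class by (subst sum.remove[of _ x]) auto
    also have "(\<Sum>w\<in>E `` {x} - {x}. CC x w) = (\<Sum>w\<in>E `` {x} - {x}. CC x y)"
      using E_eq by (intro sum.cong refl CC_const[OF rels_mem(2) _ 2]) auto
    also have "\<dots> = (real n - 1) * CC x y"
      using E_refl[OF x] finite_class n_pos by (simp add: card_Diff_singleton card_E x of_nat_diff)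
    finally have "(real n - 1) * CC x y = - CC x x" by simp
    then have "CC x y = - CC x x / (real n - 1)"
      using n1 by (simp add: field_simps)
    then show ?thesis
      using neq xE by (simp add: CC_diag x D_def P_def)
  next
    case 3
    have nE: "(x, y) \<notin> E"
      using 3 R2_E by auto
    have "w \<in> E `` {y} \<Longrightarrow> (x, w) \<in> R2" for w
      using nE assms E_sub_F F_trans E_trans E_sym F_eq by blast
    then have "0 = (\<Sum>w\<in>E `` {y}. CC x y)"
      using CC_sum_E[OF x y] CC_const[OF rels_mem(3) _ 3] by (metis (no_types, lifting) sum.cong)
    then have "CC x y = 0"
      using n_pos by (simp add: card_E y)
    moreover have "P x y = 0"
      using nE E_refl x by (auto simp: P_def)
    ultimately show ?thesis by simp
  qed
qed

text \<open>
  Chosen so that \<open>t = (r / n) ((f - 2) m (n - r) + e)\<close>; evaluating \<open>C\<^sup>2\<close> at a pair in \<open>T\<close> then shows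
  that \<open>e\<close> is the coefficient of \<open>C\<close> in \<open>C\<^sup>2\<close>.
\<close>

definition e :: real where
  "e = real n / real r * real (intersection_number \<Omega> T S T) - (real f - 2) * (real m * (real n - real r))"

lemma CC_T:
  assumes T: "(x, y) \<in> T"
  shows "CC x y = - e * (real r / real n)"
proof -
  define q where "q = real r / real n"
  have xy: "x \<in> \<Omega>" "y \<in> \<Omega>" "(x, y) \<notin> F" "(y, x) \<notin> F"
    using T rel_subset[OF rels_mem(5)] T_F F_sym[of x y] by auto
  have symS: "(z, y) \<in> S \<longleftrightarrow> (y, z) \<in> S" for z
    by (rule sym_rel[OF rels_mem(4)])
  have symF: "(z, y) \<in> F \<longleftrightarrow> (y, z) \<in> F" for z
    by (rule F_sym)
  \<comment> \<open>The mean subtracted from the second factor contributes nothing, because row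
    \<open>x\<close> of \<open>C\<close> sums to 0 both over \<open>\<Omega>\<close> and over the
    \<open>F\<close>-class of \<open>y\<close>.\<close>
  have "CC x y = (\<Sum>z\<in>\<Omega>. C x z * of_bool ((z, y) \<in> S)) - q * (\<Sum>z\<in>\<Omega>. if (y, z) \<in> F then 0 else C x z)"
    unfolding CC_def sum_distrib_left sum_subtractf[symmetric]
  proof (intro sum.cong refl)
    fix z
    show "C x z * C z y = C x z * of_bool ((z, y) \<in> S) - q * (if (y, z) \<in> F then 0 else C x z)"
      using S_F by (auto simp: C_def[of z y] q_def symF algebra_simps)
  qed
  also have "\<dots> = (\<Sum>z\<in>\<Omega>. C x z * of_bool ((z, y) \<in> S))"
    by (simp add: sum_not_F xy C_sum C_sum_F)
  \<comment> \<open>Off \<open>F\<close>, \<open>C x z\<close> is \<open>1 - q\<close> minus the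
    indicator of \<open>T\<close>; the indicator part counts the paths that make up
    \<open>t\<close>.\<close>
  also have "\<dots> = (1 - q) * (\<Sum>z\<in>\<Omega>. if (x, z) \<in> F then 0 else of_bool ((y, z) \<in> S))
      - (\<Sum>z\<in>\<Omega>. of_bool ((x, z) \<in> T \<and> (z, y) \<in> S))"
    unfolding sum_distrib_left sum_subtractf[symmetric]
  proof (intro sum.cong refl)
    fix z assume "z \<in> \<Omega>"
    then show "C x z * of_bool ((z, y) \<in> S) = (1 - q) * (if (x, z) \<in> F then 0 else of_bool ((y, z) \<in> S))
        - of_bool ((x, z) \<in> T \<and> (z, y) \<in> S)"
      using T_iff[OF xy(1), of z] by (auto simp: C_def q_def symS)
  qed
  also have "(\<Sum>z\<in>\<Omega>. of_bool ((x, z) \<in> T \<and> (z, y) \<in> S)) = real (intersection_number \<Omega> T S T)"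
    using card_paths[OF rels_mem(5,4,5) T] finite_points by (simp add: Int_def)
  also have "(\<Sum>z\<in>\<Omega>. if (x, z) \<in> F then 0 else of_bool ((y, z) \<in> S)) =
      real (card (\<Omega> \<inter> {z. (y, z) \<in> S})) - real (card (F `` {x} \<inter> {z. (y, z) \<in> S}))"
    using finite_class finite_points by (simp add: sum_not_F xy)
  also have "\<Omega> \<inter> {z. (y, z) \<in> S} = S `` {y}"
    using rel_subset[OF rels_mem(4)] by auto
  also have "F `` {x} \<inter> {z. (y, z) \<in> S} = S `` {y} \<inter> F `` {x}"
    by auto
  \<comment> \<open>The factor \<open>f - 2\<close> arises because \<open>y\<close> has
    \<open>(f - 1) m r\<close> neighbours along \<open>S\<close>, of which \<open>m r\<close> lie in
    the \<open>F\<close>-class of \<open>x\<close>.\<close>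
  finally have "CC x y = (1 - q) * ((real f - 2) * (real m * real r)) - real (intersection_number \<Omega> T S T)"
    by (simp add: card_S[OF xy(2)] card_S_F[OF xy(2,1,4)] algebra_simps)
  moreover have "e * q = real (intersection_number \<Omega> T S T) - (1 - q) * ((real f - 2) * (real m * real r))"
  proof -
    have "real n / real r * q = 1" "(real n - real r) * q = (1 - q) * real r"
      using r_pos n_pos by (simp_all add: q_def field_simps)
    then show ?thesis
      unfolding e_def by algebra
  qed
  ultimately show ?thesis by (simp add: q_def)
qed

text \<open>Forced by \<open>CC_T\<close>: as seen from \<open>x\<close>, the \<open>E\<close>-class
  of \<open>y\<close> has \<open>r\<close> points in \<open>S\<close> and \<open>n - r\<close> in
  \<open>T\<close>, and \<open>CC\<close> sums to 0 over it.\<close>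

lemma CC_S:
  assumes S: "(x, y) \<in> S"
  shows "CC x y = e * (1 - real r / real n)"
proof -
  have xy: "x \<in> \<Omega>" "y \<in> \<Omega>" "(x, y) \<notin> F"
    using S rel_subset[OF rels_mem(4)] S_F by auto
  have out: "w \<in> \<Omega>" "(x, w) \<notin> F" if "w \<in> E `` {y}" for w
    using that E_\<Omega> E_sub_F F_cong[of y w x] xy by auto
  have "0 = (\<Sum>w\<in>E `` {y}. CC x w)"
    using CC_sum_E xy by simp
  also have "\<dots> = (\<Sum>w\<in>E `` {y}. of_bool ((x, w) \<in> S) * (CC x y + e * (real r / real n)) - e * (real r / real n))"
  proof (intro sum.cong refl)
    fix w assume w: "w \<in> E `` {y}"
    show "CC x w = of_bool ((x, w) \<in> S) * (CC x y + e * (real r / real n)) - e * (real r / real n)"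
    proof (cases "(x, w) \<in> S")
      case True
      then show ?thesis using CC_const[OF rels_mem(4) True S] by simp
    next
      case False
      then have "(x, w) \<in> T" using out[OF w] not_F xy by blast
      then show ?thesis using CC_T False by simp
    qed
  qed
  also have "\<dots> = real (card (E `` {y} \<inter> {w. (x, w) \<in> S})) * (CC x y + e * (real r / real n)) - e * real r"
    unfolding sum_subtractf sum_distrib_right[symmetric] using finite_class n_pos by (simp add: card_E xy)
  also have "E `` {y} \<inter> {w. (x, w) \<in> S} = S `` {x} \<inter> E `` {y}"
    by auto
  finally have "real r * (CC x y + e * (real r / real n)) = real r * e"
    using card_S_E[OF xy] by simp
  then have "CC x y + e * (real r / real n) = e"
    using r_pos by simp
  then show ?thesis by (simp add: algebra_simps)
qed

lemma CC_eq:
  assumes "x \<in> \<Omega>" "y \<in> \<Omega>"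
  shows "CC x y = (real f - 1) * D * P x y + e * C x y"
proof (cases "(x, y) \<in> F")
  case True
  then show ?thesis by (simp add: CC_F C_F)
next
  case False
  then have "(x, y) \<in> S \<or> (x, y) \<in> T"
    using not_F assms by blast
  then show ?thesis
    using False CC_S CC_T T_iff[OF assms] by (auto simp: P_F assms C_def algebra_simps)
qed

section \<open>Products of blocks of \<open>C\<close> through one class\<close>

definition path_sum :: "'a set \<Rightarrow> 'a \<Rightarrow> 'a \<Rightarrow> real" where
  "path_sum \<Gamma> x y = (\<Sum>z\<in>\<Gamma>. C x z * C z y)"

lemma notin_class:
  assumes "\<Gamma> \<in> \<Omega> // F" "x \<notin> \<Gamma>" "z \<in> \<Gamma>"
  shows "(x, z) \<notin> F" "(z, x) \<notin> F"
proof -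
  have "\<Gamma> = F `` {z}" using class_eq assms by blast
  with assms show "(z, x) \<notin> F" by auto
  then show "(x, z) \<notin> F" using F_sym by blast
qed

lemma path_sum_eq_0:
  assumes "\<Gamma> \<in> \<Omega> // F" "x \<in> \<Gamma> \<or> y \<in> \<Gamma>"
  shows "path_sum \<Gamma> x y = 0"
proof -
  have "(x, z) \<in> F \<or> (z, y) \<in> F" if "z \<in> \<Gamma>" for z
    using assms class_eq[OF assms(1)] that by blast
  then show ?thesis
    unfolding path_sum_def using C_F by (intro sum.neutral ballI) fastforce
qed

text \<open>In the expanded product, all terms containing a mean depend on the parameters only. The
  constant difference links the real matrix \<open>C\<close> with the integer coefficients of
  uniformity.\<close>

lemma path_sum_eq_card:
  assumes \<Gamma>: "\<Gamma> \<in> \<Omega> // F" and x: "x \<in> \<Omega>" "x \<notin> \<Gamma>" and y: "y \<in> \<Omega>" "y \<notin> \<Gamma>"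
  shows "path_sum \<Gamma> x y = real (card {z \<in> \<Gamma>. (x, z) \<in> S \<and> (z, y) \<in> S}) - real m * real r * (real r / real n)"
proof -
  define q where "q = real r / real n"
  obtain w where w: "w \<in> \<Omega>" "\<Gamma> = F `` {w}"
    using class_rep[OF \<Gamma>] by blast
  have fin: "finite \<Gamma>"
    using w finite_class by simp
  have "path_sum \<Gamma> x y = (\<Sum>z\<in>\<Gamma>. of_bool ((x, z) \<in> S \<and> (z, y) \<in> S)) - q * (\<Sum>z\<in>\<Gamma>. of_bool ((y, z) \<in> S)) - q * (\<Sum>z\<in>\<Gamma>. C x z)"
    unfolding path_sum_def sum_distrib_left sum_subtractf[symmetric]
  proof (intro sum.cong refl)
    fix z assume "z \<in> \<Gamma>"
    then show "C x z * C z y = of_bool ((x, z) \<in> S \<and> (z, y) \<in> S) - q * of_bool ((y, z) \<in> S) - q * C x z"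
      using notin_class[OF \<Gamma>] x y sym_rel[OF rels_mem(4), of z y] by (simp add: C_def q_def algebra_simps)
  qed
  also have "(\<Sum>z\<in>\<Gamma>. C x z) = 0"
    using C_sum_F w x by simp
  also have "(\<Sum>z\<in>\<Gamma>. of_bool ((y, z) \<in> S)) = real (card (\<Gamma> \<inter> {z. (y, z) \<in> S}))"
    using fin by simp
  also have "\<Gamma> \<inter> {z. (y, z) \<in> S} = S `` {y} \<inter> F `` {w}"
    using w by auto
  also have "card \<dots> = m * r"
    using notin_class[OF \<Gamma> y(2), of w] F_refl w y by (intro card_S_F) auto
  also have "(\<Sum>z\<in>\<Gamma>. of_bool ((x, z) \<in> S \<and> (z, y) \<in> S)) = real (card {z \<in> \<Gamma>. (x, z) \<in> S \<and> (z, y) \<in> S})"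
    using fin by (simp add: Int_def)
  finally show ?thesis by (simp add: q_def)
qed

section \<open>Independence of the class and the eigenvalue condition\<close>

lemma CC_path_sum: "CC x y = (\<Sum>\<Gamma>\<in>\<Omega> // F. path_sum \<Gamma> x y)"
  unfolding CC_def path_sum_def by (rule sum_classes)

lemma finite_quotient: "finite (\<Omega> // F)"
  using finite_points partition_F finite_elements by blast

lemma D_pos: "D > 0"
  using r_pos r_less m_pos by (simp add: D_def)

lemma C_nonzero: "(x, y) \<notin> F \<Longrightarrow> C x y \<noteq> 0"
  using r_pos r_less by (simp add: C_def)

lemma eigenvalue_if_path_sum_independent:
  assumes indep: "\<And>\<Gamma> \<Gamma>' x y. \<lbrakk>\<Gamma> \<in> \<Omega> // F; \<Gamma>' \<in> \<Omega> // F; x \<in> \<Omega> - \<Gamma> - \<Gamma>'; y \<in> \<Omega> - \<Gamma> - \<Gamma>'\<rbrakk>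
      \<Longrightarrow> path_sum \<Gamma> x y = path_sum \<Gamma>' x y"
  shows "\<exists>\<delta>. \<delta>\<^sup>2 = D \<and> e = (real f - 2) * \<delta>"
proof -
  \<comment> \<open>The classes of \<open>x\<close> and \<open>y\<close> contribute 0 to
    \<open>CC x y\<close>, and the remaining \<open>f - 1\<close> or \<open>f - 2\<close> classes
    contribute equally.\<close>
  have loc_sum: "CC x y = (real f - real (card {F `` {x}, F `` {y}})) * path_sum \<Gamma> x y"
    if \<Gamma>: "\<Gamma> \<in> \<Omega> // F" and x: "x \<in> \<Omega> - \<Gamma>" and y: "y \<in> \<Omega> - \<Gamma>" for \<Gamma> x y
  proof -
    have cl: "F `` {x} \<in> \<Omega> // F" "F `` {y} \<in> \<Omega> // F"
      using x y by (auto intro: quotientI)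
    have mem: "x \<in> F `` {x}" "y \<in> F `` {y}"
      using F_refl x y by auto
    have "CC x y = (\<Sum>\<Gamma>'\<in>\<Omega> // F - {F `` {x}, F `` {y}}. path_sum \<Gamma>' x y)"
      unfolding CC_path_sum using finite_quotient path_sum_eq_0 cl mem
      by (intro sum.mono_neutral_right) auto
    also have "\<dots> = (\<Sum>\<Gamma>'\<in>\<Omega> // F - {F `` {x}, F `` {y}}. path_sum \<Gamma> x y)"
    proof (intro sum.cong refl indep \<Gamma>)
      fix \<Gamma>' assume \<Gamma>': "\<Gamma>' \<in> \<Omega> // F - {F `` {x}, F `` {y}}"
      then show "\<Gamma>' \<in> \<Omega> // F" by simp
      have "x \<notin> \<Gamma>'" "y \<notin> \<Gamma>'"
        using \<Gamma>' class_eq by blast+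
      then show "x \<in> \<Omega> - \<Gamma>' - \<Gamma>" "y \<in> \<Omega> - \<Gamma>' - \<Gamma>"
        using x y by auto
    qed
    also have "\<dots> = (real f - real (card {F `` {x}, F `` {y}})) * path_sum \<Gamma> x y"
    proof -
      have "card {F `` {x}, F `` {y}} \<le> 2"
        by (simp add: card_insert_if)
      then show ?thesis
        using cl f_ge by (simp add: card_Diff_subset card_quotient of_nat_diff)
    qed
    finally show ?thesis .
  qed
  show ?thesis
  proof (cases "f = 2")
    \<comment> \<open>With two classes, no class avoids both ends of a pair off \<open>F\<close>.
      Hence \<open>CC\<close> vanishes on \<open>T\<close>, \<open>e\<close> is 0, and as
      \<open>f - 2 = 0\<close> either square root of \<open>D\<close> will do.\<close>
    case True
    obtain x y where xy: "(x, y) \<in> T"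
      using rel_nonempty[OF rels_mem(5)] by fast
    then have "x \<in> \<Omega>" "y \<in> \<Omega>" "(x, y) \<notin> F"
      using rel_subset[OF rels_mem(5)] T_F by auto
    then have "F `` {x} \<noteq> F `` {y}" "F `` {x} \<in> \<Omega> // F" "F `` {y} \<in> \<Omega> // F"
      using F_refl by (auto intro: quotientI)
    then have "\<Omega> // F = {F `` {x}, F `` {y}}"
      using True finite_quotient card_quotient by (intro card_seteq[symmetric]) auto
    moreover have "path_sum (F `` {x}) x y = 0" "path_sum (F `` {y}) x y = 0"
      using \<open>F `` {x} \<in> \<Omega> // F\<close> \<open>F `` {y} \<in> \<Omega> // F\<close> F_refl \<open>x \<in> \<Omega>\<close> \<open>y \<in> \<Omega>\<close>
      by (auto intro: path_sum_eq_0)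
    ultimately have "CC x y = 0"
      unfolding CC_path_sum by (intro sum.neutral) auto
    then have "e = 0"
      using CC_T[OF xy] r_pos n_pos by simp
    then show ?thesis
      using True D_pos by (intro exI[of _ "sqrt D"]) simp
  next
    case False
    then have f3: "f \<ge> 3" using f_ge by simp
    define \<delta> where "\<delta> = e / (real f - 2)"
    have e: "e = (real f - 2) * \<delta>"
      using f3 by (simp add: \<delta>_def)
    have loc_off: "path_sum \<Gamma> x y = \<delta> * C x y"
      if "\<Gamma> \<in> \<Omega> // F" "x \<in> \<Omega> - \<Gamma>" "y \<in> \<Omega> - \<Gamma>" "(x, y) \<notin> F" for \<Gamma> x y
    proof -
      have "F `` {x} \<noteq> F `` {y}"
        using that F_refl by auto
      then have "(real f - 2) * path_sum \<Gamma> x y = (real f - 2) * (\<delta> * C x y)"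
        using loc_sum[OF that(1-3)] CC_eq[of x y] that e by (simp add: P_F)
      then show ?thesis using f3 by simp
    qed
    have loc_on: "path_sum \<Gamma> x y = D * P x y"
      if "\<Gamma> \<in> \<Omega> // F" "x \<in> \<Omega> - \<Gamma>" "y \<in> \<Omega> - \<Gamma>" "(x, y) \<in> F" for \<Gamma> x y
    proof -
      have "F `` {x} = F `` {y}"
        using that equiv_F by (meson equiv_class_eq)
      then have "(real f - 1) * path_sum \<Gamma> x y = (real f - 1) * (D * P x y)"
        using loc_sum[OF that(1-3)] CC_F[of x y] that by auto
      then show ?thesis using f3 by simp
    qed
    obtain \<Delta> \<Gamma> \<Lambda> where cl: "\<Delta> \<in> \<Omega> // F" "\<Gamma> \<in> \<Omega> // F" "\<Lambda> \<in> \<Omega> // F"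
      and ne: "\<Delta> \<noteq> \<Gamma>" "\<Delta> \<noteq> \<Lambda>" "\<Gamma> \<noteq> \<Lambda>"
      using card_le_Suc_iff[of 2 "\<Omega> // F"] card_quotient f3
      by (metis card_3_iff obtain_subset_with_card_n insert_subset)
    obtain x y where x: "x \<in> \<Omega>" "\<Delta> = F `` {x}" and y: "y \<in> \<Omega>" "\<Gamma> = F `` {y}"
      using class_rep cl by meson
    have disj: "\<Delta> \<inter> \<Gamma> = {}" "\<Delta> \<inter> \<Lambda> = {}" "\<Gamma> \<inter> \<Lambda> = {}"
      using partition_F cl ne by (auto simp: partition_on_def disjoint_def)
    have xin: "x \<in> \<Delta>" and yin: "y \<in> \<Gamma>"
      using x y F_refl by auto
    \<comment> \<open>The sum of \<open>C x z * C z w * C w y\<close> over \<open>z\<close> in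
      \<Gamma> and \<open>w\<close> in \<Lambda> is computed twice. Summing over \<open>w\<close>
      first gives \<open>D * P z y\<close>, since \<open>z\<close> and \<open>y\<close> share a
      class. Summing over \<open>z\<close> first gives \<open>\<delta> * C x w\<close>, and the
      remaining sum over \<open>w\<close> yields a second factor \<delta>.\<close>
    have "D * C x y = (\<Sum>z\<in>\<Gamma>. C x z * (D * P z y))"
    proof -
      have "(\<Sum>z\<in>\<Gamma>. P y z * C z x) = C y x"
        using P_C[OF y(1) x(1)] y by simp
      then have "(\<Sum>z\<in>\<Gamma>. C x z * P z y) = C x y"
        by (simp only: C_sym[of x] P_sym[of _ y] mult.commute)
      then show ?thesis
        by (simp add: sum_distrib_left[symmetric] mult.left_commute[of _ D])
    qed
    also have "\<dots> = (\<Sum>z\<in>\<Gamma>. C x z * path_sum \<Lambda> z y)"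
    proof (intro sum.cong refl)
      fix z assume z: "z \<in> \<Gamma>"
      have "(z, y) \<in> F" using z y F_sym by auto
      moreover have "z \<in> \<Omega> - \<Lambda>" "y \<in> \<Omega> - \<Lambda>"
        using z yin disj class_sub cl by blast+
      ultimately show "C x z * (D * P z y) = C x z * path_sum \<Lambda> z y"
        by (simp add: loc_on cl)
    qed
    also have "\<dots> = (\<Sum>z\<in>\<Gamma>. \<Sum>w\<in>\<Lambda>. C x z * C z w * C w y)"
      by (simp add: path_sum_def sum_distrib_left mult.assoc)
    also have "\<dots> = (\<Sum>w\<in>\<Lambda>. \<Sum>z\<in>\<Gamma>. C x z * C z w * C w y)"
      by (rule sum.swap)
    also have "\<dots> = (\<Sum>w\<in>\<Lambda>. path_sum \<Gamma> x w * C w y)"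
      by (simp add: path_sum_def sum_distrib_right)
    also have "\<dots> = (\<Sum>w\<in>\<Lambda>. \<delta> * (C x w * C w y))"
    proof (intro sum.cong refl)
      fix w assume w: "w \<in> \<Lambda>"
      have "(x, w) \<notin> F" using w disj x by auto
      moreover have "x \<in> \<Omega> - \<Gamma>" "w \<in> \<Omega> - \<Gamma>"
        using w xin disj class_sub cl by blast+
      ultimately show "path_sum \<Gamma> x w * C w y = \<delta> * (C x w * C w y)"
        by (simp add: loc_off cl)
    qed
    also have "\<dots> = \<delta> * path_sum \<Lambda> x y"
      by (simp add: path_sum_def sum_distrib_left)
    also have "path_sum \<Lambda> x y = \<delta> * C x y"
      using xin yin disj cl class_sub x y by (intro loc_off) auto
    finally have "D * C x y = \<delta>\<^sup>2 * C x y"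
      by (simp add: power2_eq_square)
    moreover have "C x y \<noteq> 0"
      using yin disj x by (intro C_nonzero) auto
    ultimately have "\<delta>\<^sup>2 = D" by simp
    then show ?thesis using e by blast
  qed
qed

text \<open>An instance of \<open>block_idempotent\<close> for \<open>L = P + C / \<delta>\<close>.
  Between a point outside \<Gamma> and a point of \<Gamma>, \<open>L\<close> is just
  \<open>C / \<delta>\<close>, so its product through \<Gamma> is \<open>path_sum\<close> divided by
  \<open>\<delta>\<^sup>2\<close>.\<close>

lemma path_sum_if_eigenvalue:
  assumes \<delta>: "\<delta>\<^sup>2 = D" and e: "e = (real f - 2) * \<delta>"
    and \<Gamma>: "\<Gamma> \<in> \<Omega> // F" and x: "x \<in> \<Omega> - \<Gamma>" and y: "y \<in> \<Omega> - \<Gamma>"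
  shows "path_sum \<Gamma> x y = D * P x y + \<delta> * C x y"
proof -
  define L where "L u v = P u v + C u v / \<delta>" for u v
  have \<delta>0: "\<delta> \<noteq> 0"
    using \<delta> D_pos by auto
  have P_sum: "(\<Sum>z\<in>\<Omega>. P u z * g z) = (\<Sum>z\<in>F `` {u}. P u z * g z)" if "u \<in> \<Omega>" for u and g :: "'a \<Rightarrow> real"
    using finite_points F_\<Omega> P_F[OF that] by (intro sum.mono_neutral_right) auto
  have PC: "(\<Sum>z\<in>\<Omega>. P u z * C z v) = C u v" if "u \<in> \<Omega>" "v \<in> \<Omega>" for u v
    using that by (simp add: P_sum P_C)
  have PP: "(\<Sum>z\<in>\<Omega>. P u z * P z v) = P u v" if "u \<in> \<Omega>" "v \<in> \<Omega>" for u v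
    using that by (simp add: P_sum P_P)
  have CP: "(\<Sum>z\<in>\<Omega>. C u z * P z v) = C u v" if "u \<in> \<Omega>" "v \<in> \<Omega>" for u v
    using PC[OF that(2,1)] by (simp only: C_sym[of u] P_sym[of _ v] mult.commute)
  have "(\<Sum>z\<in>\<Gamma>. L x z * L z y) = L x y"
  proof (rule block_idempotent[OF finite_points partition_F _ _ _ \<Gamma>])
    show "L u v = L v u" for u v
      by (simp add: L_def C_sym[of u v] P_sym[of u v])
    show "(\<Sum>z\<in>\<Omega>. L u z * L z v) = real (card (\<Omega> // F)) * L u v" if uv: "u \<in> \<Omega>" "v \<in> \<Omega>" for u v
    proof -
      have "(\<Sum>z\<in>\<Omega>. L u z * L z v) = (\<Sum>z\<in>\<Omega>. P u z * P z v) + (\<Sum>z\<in>\<Omega>. P u z * C z v) / \<delta>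
          + (\<Sum>z\<in>\<Omega>. C u z * P z v) / \<delta> + CC u v / \<delta>\<^sup>2"
        unfolding CC_def sum_divide_distrib sum.distrib[symmetric]
        by (intro sum.cong refl) (simp add: L_def algebra_simps power2_eq_square)
      \<comment> \<open>By \<open>\<delta>\<^sup>2 = D\<close> the coefficients become
        \<open>1 + (f - 1)\<close> for \<open>P\<close> and \<open>2 + (f - 2)\<close> for
        \<open>C / \<delta>\<close>, both equal to \<open>f\<close>.\<close>
      also have "\<dots> = P u v + 2 * C u v / \<delta> + ((real f - 1) * D * P u v + (real f - 2) * \<delta> * C u v) / \<delta>\<^sup>2"
        using uv e by (simp add: PP PC CP CC_eq)
      also have "\<dots> = real f * L u v"
        using \<delta>0 by (simp add: \<delta>[symmetric] L_def field_simps power2_eq_square)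
      finally show ?thesis by (simp add: card_quotient)
    qed
    \<comment> \<open>\<open>C\<close> vanishes inside an \<open>F\<close>-class, so the diagonal
      blocks of \<open>L\<close> are those of \<open>P\<close>, and multiplication by
      \<open>P\<close> fixes both \<open>P\<close> and \<open>C\<close>.\<close>
    show "(\<Sum>z\<in>G. L u z * L z v) = L u v" if G: "G \<in> \<Omega> // F" "u \<in> G" and v: "v \<in> \<Omega>" for G u v
    proof -
      have u: "u \<in> \<Omega>" "G = F `` {u}"
        using G class_sub class_eq by blast+
      have "(\<Sum>z\<in>G. L u z * L z v) = (\<Sum>z\<in>F `` {u}. P u z * P z v) + (\<Sum>z\<in>F `` {u}. P u z * C z v) / \<delta>"
        unfolding u(2) sum_divide_distrib sum.distrib[symmetric]
        by (intro sum.cong refl) (simp add: L_def C_F algebra_simps)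
      then show ?thesis using u v by (simp add: P_P P_C L_def)
    qed
  qed (use x y in auto)
  moreover have "(\<Sum>z\<in>\<Gamma>. L x z * L z y) = path_sum \<Gamma> x y / \<delta>\<^sup>2"
    unfolding path_sum_def sum_divide_distrib
  proof (intro sum.cong refl)
    fix z assume z: "z \<in> \<Gamma>"
    then have "z \<in> \<Omega>" using class_sub[OF \<Gamma>] by blast
    then have "P x z = 0" "P z y = 0"
      using notin_class[OF \<Gamma> _ z] x y by (auto intro: P_F)
    then show "L x z * L z y = C x z * C z y / \<delta>\<^sup>2"
      by (simp add: L_def power2_eq_square)
  qed
  ultimately have "path_sum \<Gamma> x y = \<delta>\<^sup>2 * L x y"
    using \<delta>0 by (simp add: field_simps)
  also have "\<dots> = \<delta>\<^sup>2 * P x y + \<delta> * C x y"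
    using \<delta>0 by (simp add: L_def field_simps power2_eq_square)
  finally show ?thesis
    by (simp add: \<delta>)
qed

section \<open>The quotients by \<open>E\<close> and \<open>F\<close>\<close>

lemma points_nonempty: "\<Omega> \<noteq> {}"
  using rel_nonempty[OF rels_mem(4)] rel_subset[OF rels_mem(4)] by blast

text \<open>The diagonal, \<open>R2\<close> and \<open>S\<close> have distinct images in the
  quotient. This excludes \<open>E\<close> as the parabolic of corank 2, which
  \<open>uniform\<close> leaves unspecified.\<close>

lemma cork_E: "cork \<Omega> \<R> E \<ge> 3"
proof -
  have mem: "(E `` {x}, E `` {y}) \<in> quotient_rel \<Omega> E R" if "(x, y) \<in> R" "R \<in> \<R>" for x y R
  proof -
    have "x \<in> \<Omega>" "y \<in> \<Omega>"
      using that rel_subset[OF that(2)] by auto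
    then have "(x, y) \<in> R \<inter> (E `` {x} \<times> E `` {y})" "E `` {x} \<in> \<Omega> // E" "E `` {y} \<in> \<Omega> // E"
      using that E_refl by (auto intro: quotientI)
    then show ?thesis
      unfolding quotient_rel_def by blast
  qed
  obtain x where x: "x \<in> \<Omega>"
    using points_nonempty by blast
  obtain u v where uv: "(u, v) \<in> R2"
    using rel_nonempty[OF rels_mem(3)] by fast
  have xE: "(E `` {x}, E `` {x}) \<notin> quotient_rel \<Omega> E R" if "R \<inter> E = {}" for R
    using that E_trans E_sym by (auto simp: quotient_rel_def)
  have uvF: "(E `` {u}, E `` {v}) \<notin> quotient_rel \<Omega> E S"
  proof
    assume "(E `` {u}, E `` {v}) \<in> quotient_rel \<Omega> E S"
    then obtain a b where "(a, b) \<in> S" "(u, a) \<in> F" "(v, b) \<in> F"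
      using E_sub_F by (auto simp: quotient_rel_def)
    moreover have "(u, v) \<in> F" using uv F_eq by simp
    ultimately have "(a, b) \<in> F" using F_trans F_sym by blast
    then show False using \<open>(a, b) \<in> S\<close> S_F by auto
  qed
  have "(x, x) \<in> Id_on \<Omega>" using x by blast
  then have "quotient_rel \<Omega> E (Id_on \<Omega>) \<noteq> quotient_rel \<Omega> E R2"
      "quotient_rel \<Omega> E (Id_on \<Omega>) \<noteq> quotient_rel \<Omega> E S"
    using mem[OF _ rels_mem(1)] xE[OF R2_E] xE[of S] S_F E_sub_F by blast+
  moreover have "quotient_rel \<Omega> E R2 \<noteq> quotient_rel \<Omega> E S"
    using mem[OF uv rels_mem(3)] uvF by blast
  ultimately have "card {quotient_rel \<Omega> E (Id_on \<Omega>), quotient_rel \<Omega> E R2, quotient_rel \<Omega> E S} = 3"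
    by simp
  moreover have "{quotient_rel \<Omega> E (Id_on \<Omega>), quotient_rel \<Omega> E R2, quotient_rel \<Omega> E S} \<subseteq> quotient_scheme \<Omega> \<R> E"
    using rels_mem by (auto simp: quotient_scheme_def)
  ultimately show ?thesis
    unfolding cork_def using finite_rels card_mono[of "quotient_scheme \<Omega> \<R> E"]
    by (metis finite_imageI quotient_scheme_def)
qed

lemma card_S_class:
  assumes \<Gamma>: "\<Gamma> \<in> \<Omega> // F" and x: "x \<in> \<Omega>" "x \<notin> \<Gamma>"
  shows "card {z \<in> \<Gamma>. (x, z) \<in> S} = m * r" "card {z \<in> \<Gamma>. (x, z) \<in> T} = m * n - m * r"
proof -
  obtain w where w: "w \<in> \<Omega>" "\<Gamma> = F `` {w}"
    using class_rep[OF \<Gamma>] by blast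
  have fin: "finite \<Gamma>"
    using w finite_class by simp
  have "(x, w) \<notin> F"
    using notin_class[OF \<Gamma> x(2), of w] F_refl w by auto
  moreover have eq: "{z \<in> \<Gamma>. (x, z) \<in> S} = S `` {x} \<inter> F `` {w}"
    using w by auto
  ultimately show S: "card {z \<in> \<Gamma>. (x, z) \<in> S} = m * r"
    using card_S_F x w by simp
  have "{z \<in> \<Gamma>. (x, z) \<in> T} = \<Gamma> - {z \<in> \<Gamma>. (x, z) \<in> S}"
    using T_iff[OF x(1)] notin_class[OF \<Gamma> x(2)] class_sub[OF \<Gamma>] by blast
  then have "card {z \<in> \<Gamma>. (x, z) \<in> T} = card \<Gamma> - card {z \<in> \<Gamma>. (x, z) \<in> S}"
    using fin by (simp only:) (rule card_Diff_subset; auto)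
  then show "card {z \<in> \<Gamma>. (x, z) \<in> T} = m * n - m * r"
    using S w(2) card_F[OF w(1)] by simp
qed

text \<open>Since \<open>0 < r < n\<close>, each point has neighbours of both kinds in every
  \<open>F\<close>-class other than its own.\<close>

lemma S_T_meet_classes:
  assumes "\<Delta> \<in> \<Omega> // F" "\<Gamma> \<in> \<Omega> // F" "\<Delta> \<noteq> \<Gamma>" "R = S \<or> R = T"
  shows "R \<in> meeting_rels \<R> \<Delta> \<Gamma>"
proof -
  obtain x where x: "x \<in> \<Omega>" "\<Delta> = F `` {x}" "x \<in> \<Delta>"
    using class_rep[OF assms(1)] F_refl by auto
  have "x \<notin> \<Gamma>"
    using class_eq[OF assms(2), of x] assms(3) x(2) by blast
  then have "card {z \<in> \<Gamma>. (x, z) \<in> R} > 0"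
    using card_S_class[OF assms(2) x(1)] assms(4) m_pos r_pos r_less by auto
  then obtain z where "z \<in> \<Gamma>" "(x, z) \<in> R"
    by (metis (no_types, lifting) card.empty empty_Collect_eq less_irrefl)
  then show ?thesis
    using x assms(4) rels_mem by (auto simp: meeting_rels_def)
qed

lemma quotient_rel_F:
  assumes "R \<in> \<R>"
  shows "quotient_rel \<Omega> F R = (if R \<subseteq> F then Id_on (\<Omega> // F) else (\<Omega> // F) \<times> (\<Omega> // F) - Id_on (\<Omega> // F))"
proof (cases "R \<subseteq> F")
  case True
  have "(\<Delta>, \<Gamma>) \<in> quotient_rel \<Omega> F R \<longleftrightarrow> \<Delta> \<in> \<Omega> // F \<and> \<Gamma> = \<Delta>" for \<Delta> \<Gamma>
  proof
    assume "(\<Delta>, \<Gamma>) \<in> quotient_rel \<Omega> F R"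
    then obtain x y where xy: "\<Delta> \<in> \<Omega> // F" "\<Gamma> \<in> \<Omega> // F" "x \<in> \<Delta>" "y \<in> \<Gamma>" "(x, y) \<in> F"
      using True by (auto simp: quotient_rel_def)
    then have "\<Delta> = F `` {x}" "\<Gamma> = F `` {y}"
      using class_eq by blast+
    then show "\<Delta> \<in> \<Omega> // F \<and> \<Gamma> = \<Delta>"
      using xy equiv_class_eq[OF equiv_F xy(5)] by simp
  next
    assume \<Delta>: "\<Delta> \<in> \<Omega> // F \<and> \<Gamma> = \<Delta>"
    obtain u v where uv: "(u, v) \<in> R"
      using rel_nonempty[OF assms] by fast
    obtain x where x: "x \<in> \<Omega>" "\<Delta> = F `` {x}"
      using class_rep \<Delta> by blast
    have "(x, x) \<in> Id_on \<Omega>" "(u, u) \<in> Id_on \<Omega>"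
      using x rel_subset[OF assms] uv by auto
    \<comment> \<open>The number of closed paths along \<open>R\<close> is the same at every point.
      As \<open>u\<close> has one through \<open>v\<close>, so has \<open>x\<close>, which gives a
      pair of \<open>R\<close> inside the class of \<open>x\<close>.\<close>
    then have "card {z \<in> \<Omega>. (x, z) \<in> R \<and> (z, x) \<in> R} = card {z \<in> \<Omega>. (u, z) \<in> R \<and> (z, u) \<in> R}"
      by (simp only: card_paths[OF assms assms rels_mem(1)])
    moreover have "v \<in> {z \<in> \<Omega>. (u, z) \<in> R \<and> (z, u) \<in> R}"
      using uv rel_subset[OF assms] sym_rel[OF assms, of u v] by auto
    moreover have "finite {z \<in> \<Omega>. (u, z) \<in> R \<and> (z, u) \<in> R}"
      using finite_points by simp
    ultimately have "{z \<in> \<Omega>. (x, z) \<in> R \<and> (z, x) \<in> R} \<noteq> {}"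
      by (metis (no_types, lifting) card_0_eq card.empty empty_iff)
    then show "(\<Delta>, \<Gamma>) \<in> quotient_rel \<Omega> F R"
      using \<Delta> x True F_refl by (auto simp: quotient_rel_def)
  qed
  then show ?thesis using True by auto
next
  case False
  then have ST: "R = S \<or> R = T"
    using assms rels F_eq E_eq by auto
  have "(\<Delta>, \<Gamma>) \<in> quotient_rel \<Omega> F R \<longleftrightarrow> \<Delta> \<in> \<Omega> // F \<and> \<Gamma> \<in> \<Omega> // F \<and> \<Delta> \<noteq> \<Gamma>" for \<Delta> \<Gamma>
  proof
    assume "(\<Delta>, \<Gamma>) \<in> quotient_rel \<Omega> F R"
    then obtain x y where xy: "\<Delta> \<in> \<Omega> // F" "\<Gamma> \<in> \<Omega> // F" "x \<in> \<Delta>" "y \<in> \<Gamma>" "(x, y) \<in> R"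
      by (auto simp: quotient_rel_def)
    then have "(x, y) \<notin> F"
      using ST S_F T_F by auto
    then show "\<Delta> \<in> \<Omega> // F \<and> \<Gamma> \<in> \<Omega> // F \<and> \<Delta> \<noteq> \<Gamma>"
      using xy class_eq[OF xy(1,3)] by auto
  next
    assume "\<Delta> \<in> \<Omega> // F \<and> \<Gamma> \<in> \<Omega> // F \<and> \<Delta> \<noteq> \<Gamma>"
    then show "(\<Delta>, \<Gamma>) \<in> quotient_rel \<Omega> F R"
      using S_T_meet_classes[of \<Delta> \<Gamma> R] ST by (auto simp: meeting_rels_def quotient_rel_def)
  qed
  then show ?thesis using False by auto
qed

lemma cork_F: "cork \<Omega> \<R> F = 2"
proof -
  have sub: "Id_on \<Omega> \<subseteq> F" "R1 \<subseteq> F" "R2 \<subseteq> F" "\<not> S \<subseteq> F" "\<not> T \<subseteq> F"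
    using F_eq E_eq S_F T_F rel_nonempty rels_mem by blast+
  have "quotient_scheme \<Omega> \<R> F = {quotient_rel \<Omega> F (Id_on \<Omega>), quotient_rel \<Omega> F R1, quotient_rel \<Omega> F R2,
      quotient_rel \<Omega> F S, quotient_rel \<Omega> F T}"
    unfolding quotient_scheme_def by (simp add: rels)
  also have "\<dots> = {Id_on (\<Omega> // F), (\<Omega> // F) \<times> (\<Omega> // F) - Id_on (\<Omega> // F)}"
    by (simp add: quotient_rel_F rels_mem sub)
  finally have eq: "quotient_scheme \<Omega> \<R> F = {Id_on (\<Omega> // F), (\<Omega> // F) \<times> (\<Omega> // F) - Id_on (\<Omega> // F)}" .
  obtain x where "x \<in> \<Omega>"
    using points_nonempty by blast
  then have "F `` {x} \<in> \<Omega> // F"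
    by (rule quotientI)
  then have "Id_on (\<Omega> // F) \<noteq> (\<Omega> // F) \<times> (\<Omega> // F) - Id_on (\<Omega> // F)"
    by blast
  then show ?thesis
    unfolding cork_def eq by simp
qed

section \<open>Uniformity and path sums\<close>

lemma path_sum_independent_if_uniform:
  assumes "uniform \<Omega> \<R>" and par: "proper_nontrivial_parabolics \<Omega> \<R> = {E, F}"
    and \<Gamma>: "\<Gamma> \<in> \<Omega> // F" "\<Gamma>' \<in> \<Omega> // F" and x: "x \<in> \<Omega> - \<Gamma> - \<Gamma>'" and y: "y \<in> \<Omega> - \<Gamma> - \<Gamma>'"
  shows "path_sum \<Gamma> x y = path_sum \<Gamma>' x y"
proof -
  obtain G and a :: "'a rel \<Rightarrow> 'a rel \<Rightarrow> 'a rel \<Rightarrow> nat" where G: "parabolic \<Omega> \<R> G" "G \<noteq> Id_on \<Omega>" "cork \<Omega> \<R> G = 2"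
    and a: "\<forall>\<Delta> \<in> \<Omega> // G. \<forall>\<Gamma> \<in> \<Omega> // G. \<forall>\<Lambda> \<in> \<Omega> // G.
        \<forall>P \<in> meeting_rels \<R> \<Delta> \<Gamma>. \<forall>Q \<in> meeting_rels \<R> \<Gamma> \<Lambda>. \<forall>x \<in> \<Omega>. \<forall>y \<in> \<Omega>.
          matrix_product \<Omega> (block (adjacency P) \<Delta> \<Gamma>) (block (adjacency Q) \<Gamma> \<Lambda>) x y =
          (\<Sum>R\<in>\<R>. int (a P Q R) * block (adjacency R) \<Delta> \<Lambda> x y)"
    using assms(1) unfolding uniform_def by blast
  \<comment> \<open>The full relation has corank 1 and \<open>E\<close> at least 3, so the parabolic
    witnessing uniformity is \<open>F\<close>.\<close>
  have "G \<noteq> \<Omega> \<times> \<Omega>"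
    using G(3) cork_full[OF points_nonempty] by auto
  then have "G \<in> {E, F}"
    unfolding par[symmetric] proper_nontrivial_parabolics_def using G by simp
  then have "G = F"
    using G(3) cork_E by auto
  note a = a[unfolded uniform_blocks_iff[OF equiv_F, of a] \<open>G = F\<close>]
  obtain R where R: "R \<in> \<R>" "(x, y) \<in> R"
    using rel_exists x y by blast
  \<comment> \<open>One and the same coefficient \<open>a S S R\<close> gives the count for every
    class avoiding \<open>x\<close> and \<open>y\<close>.\<close>
  have "card {z \<in> G. (x, z) \<in> S \<and> (z, y) \<in> S} = a S S R"
    if G: "G \<in> \<Omega> // F" and x: "x \<in> \<Omega> - G" and y: "y \<in> \<Omega> - G" for G
  proof -
    have cl: "F `` {x} \<in> \<Omega> // F" "F `` {y} \<in> \<Omega> // F" "x \<in> F `` {x}" "y \<in> F `` {y}"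
      using x y F_refl by (auto intro: quotientI)
    then have "S \<in> meeting_rels \<R> (F `` {x}) G" "S \<in> meeting_rels \<R> G (F `` {y})"
      using G x y by (auto intro!: S_T_meet_classes)
    then show ?thesis
      using a cl G R by blast
  qed
  then show ?thesis
    using path_sum_eq_card[of _ x y] \<Gamma> x y by simp
qed

lemma rel_cong:
  assumes "R \<in> \<R>" "Q \<in> \<R>" "p \<in> R" "p' \<in> R"
  shows "p \<in> Q \<longleftrightarrow> p' \<in> Q"
  using rel_unique assms by blast

text \<open>By \<open>path_sum_if_eigenvalue\<close>, the number of paths of type \<open>S\<close>,
  \<open>S\<close> through a class depends only on the relation joining the ends. The types
  involving \<open>T\<close> follow by subtraction from the constant numbers \<open>m r\<close> and
  \<open>m n - m r\<close> of neighbours in a class. Types with a step inside \<open>F\<close> are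
  governed by intersection numbers.\<close>

lemma uniform_if_eigenvalue:
  assumes \<delta>: "\<delta>\<^sup>2 = D" "e = (real f - 2) * \<delta>"
  shows "uniform \<Omega> \<R>"
proof -
  define N where "N \<Gamma> A B x y = card {z \<in> \<Gamma>. (x, z) \<in> A \<and> (z, y) \<in> B}" for \<Gamma> and A B :: "'a rel" and x y
  have split: "card {z \<in> \<Gamma>. Z z \<and> (z, y) \<in> S} + card {z \<in> \<Gamma>. Z z \<and> (z, y) \<in> T} = card {z \<in> \<Gamma>. Z z}"
    if \<Gamma>: "\<Gamma> \<in> \<Omega> // F" and y: "y \<in> \<Omega> - \<Gamma>" for \<Gamma> y Z
  proof -
    have "finite \<Gamma>"
      using class_sub[OF \<Gamma>] finite_points finite_subset by blast
    moreover have "{z \<in> \<Gamma>. Z z} = {z \<in> \<Gamma>. Z z \<and> (z, y) \<in> S} \<union> {z \<in> \<Gamma>. Z z \<and> (z, y) \<in> T}"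
      using not_F[of _ y] notin_class[OF \<Gamma>, of y] class_sub[OF \<Gamma>] y by blast
    moreover have "{z \<in> \<Gamma>. Z z \<and> (z, y) \<in> S} \<inter> {z \<in> \<Gamma>. Z z \<and> (z, y) \<in> T} = {}"
      using S_T by blast
    ultimately show ?thesis
      by (simp add: card_Un_disjoint)
  qed
  have N_sym: "N \<Gamma> A B x y = N \<Gamma> B A y x" if "A \<in> \<R>" "B \<in> \<R>" for \<Gamma> A B x y
    unfolding N_def using sym_rel[OF that(1)] sym_rel[OF that(2)] by metis
  have N1: "N \<Gamma> S S x y + N \<Gamma> S T x y = m * r" "N \<Gamma> T S x y + N \<Gamma> T T x y = m * n - m * r"
    if "\<Gamma> \<in> \<Omega> // F" "x \<in> \<Omega> - \<Gamma>" "y \<in> \<Omega> - \<Gamma>" for \<Gamma> x y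
    unfolding N_def using that by (simp_all add: split card_S_class)
  have N2: "N \<Gamma> S S x y + N \<Gamma> T S x y = m * r"
    if "\<Gamma> \<in> \<Omega> // F" "x \<in> \<Omega> - \<Gamma>" "y \<in> \<Omega> - \<Gamma>" for \<Gamma> x y
    using N1(1)[OF that(1,3,2)] N_sym rels_mem by metis
  have NSS: "N \<Gamma> S S x y = N \<Gamma>' S S x' y'"
    if "\<Gamma> \<in> \<Omega> // F" "x \<in> \<Omega> - \<Gamma>" "y \<in> \<Omega> - \<Gamma>" "\<Gamma>' \<in> \<Omega> // F" "x' \<in> \<Omega> - \<Gamma>'" "y' \<in> \<Omega> - \<Gamma>'"
      and R: "R \<in> \<R>" "(x, y) \<in> R" "(x', y') \<in> R" for \<Gamma> \<Gamma>' x y x' y' R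
  proof -
    have E: "(x, y) \<in> E \<longleftrightarrow> (x', y') \<in> E"
      unfolding E_eq using rel_cong[OF R(1) _ R(2,3)] rels_mem by blast
    moreover have "(x, y) \<in> F \<longleftrightarrow> (x', y') \<in> F"
      unfolding F_eq using rel_cong[OF R(1) _ R(2,3)] rels_mem E by blast
    moreover have "(x, y) \<in> S \<longleftrightarrow> (x', y') \<in> S"
      using rel_cong[OF R(1) _ R(2,3)] rels_mem by blast
    moreover have "x = y \<longleftrightarrow> x' = y'"
      using rel_cong[OF R(1) rels_mem(1) R(2,3)] that by auto
    ultimately have "P x y = P x' y'" "C x y = C x' y'"
      by (simp_all add: P_def C_def)
    then have "path_sum \<Gamma> x y = path_sum \<Gamma>' x' y'"
      using path_sum_if_eigenvalue[OF \<delta>] that by simp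
    then show ?thesis
      using path_sum_eq_card[of \<Gamma> x y] path_sum_eq_card[of \<Gamma>' x' y'] that by (simp add: N_def)
  qed
  have N_const: "N \<Gamma> A B x y = N \<Gamma>' A B x' y'"
    if "\<Gamma> \<in> \<Omega> // F" "x \<in> \<Omega> - \<Gamma>" "y \<in> \<Omega> - \<Gamma>" "\<Gamma>' \<in> \<Omega> // F" "x' \<in> \<Omega> - \<Gamma>'" "y' \<in> \<Omega> - \<Gamma>'"
      and R: "R \<in> \<R>" "(x, y) \<in> R" "(x', y') \<in> R" and AB: "A \<in> {S, T}" "B \<in> {S, T}" for \<Gamma> \<Gamma>' x y x' y' R A B
    using NSS[OF that(1-9)] N1[OF that(1-3)] N1[OF that(4-6)] N2[OF that(1-3)] N2[OF that(4-6)] AB by auto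
  \<comment> \<open>For two steps outside \<open>F\<close> the coefficient is the common count. It
    is an arbitrary value when no class avoids both ends of a pair in \<open>R\<close>, as for
    \<open>R = S\<close> and \<open>f = 2\<close>; then there is nothing to verify.\<close>
  define a where "a A B R = (if A \<in> {S, T} \<and> B \<in> {S, T}
      then SOME c. \<exists>\<Gamma>\<in>\<Omega> // F. \<exists>x\<in>\<Omega> - \<Gamma>. \<exists>y\<in>\<Omega> - \<Gamma>. (x, y) \<in> R \<and> c = N \<Gamma> A B x y
      else intersection_number \<Omega> A B R)" for A B R
  have "\<forall>\<Delta> \<in> \<Omega> // F. \<forall>\<Gamma> \<in> \<Omega> // F. \<forall>\<Lambda> \<in> \<Omega> // F.
        \<forall>P \<in> meeting_rels \<R> \<Delta> \<Gamma>. \<forall>Q \<in> meeting_rels \<R> \<Gamma> \<Lambda>.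
        \<forall>x \<in> \<Delta>. \<forall>y \<in> \<Lambda>. \<forall>R \<in> \<R>. (x, y) \<in> R \<longrightarrow>
          card {z \<in> \<Gamma>. (x, z) \<in> P \<and> (z, y) \<in> Q} = a P Q R"
  proof (intro ballI impI)
    fix \<Delta> \<Gamma> \<Lambda> A B x y R
    assume cl: "\<Delta> \<in> \<Omega> // F" "\<Gamma> \<in> \<Omega> // F" "\<Lambda> \<in> \<Omega> // F"
      and AB: "A \<in> meeting_rels \<R> \<Delta> \<Gamma>" "B \<in> meeting_rels \<R> \<Gamma> \<Lambda>"
      and xy: "x \<in> \<Delta>" "y \<in> \<Lambda>" and R: "R \<in> \<R>" "(x, y) \<in> R"
    have AB': "A \<in> \<R>" "B \<in> \<R>"
      using AB by (auto simp: meeting_rels_def)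
    have xy\<Omega>: "x \<in> \<Omega>" "y \<in> \<Omega>"
      using xy class_sub cl by blast+
    have same: "\<Delta>' = \<Gamma>'" if "\<Delta>' \<in> \<Omega> // F" "\<Gamma>' \<in> \<Omega> // F" and Q: "Q \<in> meeting_rels \<R> \<Delta>' \<Gamma>'" "Q \<notin> {S, T}" for \<Delta>' \<Gamma>' Q
    proof -
      have "Q \<subseteq> F"
        using that rels F_eq E_eq by (auto simp: meeting_rels_def)
      moreover obtain u v where "(u, v) \<in> Q" "u \<in> \<Delta>'" "v \<in> \<Gamma>'"
        using Q(1) by (auto simp: meeting_rels_def)
      ultimately show ?thesis
        using that class_eq equiv_class_eq[OF equiv_F] by blast
    qed
    have diff: "\<Delta>' \<inter> \<Gamma>' = {}" if "\<Delta>' \<in> \<Omega> // F" "\<Gamma>' \<in> \<Omega> // F" and Q: "Q \<in> meeting_rels \<R> \<Delta>' \<Gamma>'" "Q \<in> {S, T}" for \<Delta>' \<Gamma>' Q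
    proof -
      obtain u v where uv: "(u, v) \<in> Q" "u \<in> \<Delta>'" "v \<in> \<Gamma>'"
        using Q(1) by (auto simp: meeting_rels_def)
      then have "(u, v) \<notin> F"
        using that S_F T_F by auto
      then have "\<Delta>' \<noteq> \<Gamma>'"
        using uv class_eq[OF that(1) uv(2)] by blast
      then show ?thesis
        using partition_F that by (auto simp: partition_on_def disjoint_def)
    qed
    have QF: "Q \<subseteq> F" if "Q \<in> \<R>" "Q \<notin> {S, T}" for Q
      using that rels F_eq E_eq by auto
    show "card {z \<in> \<Gamma>. (x, z) \<in> A \<and> (z, y) \<in> B} = a A B R"
    proof (cases "A \<in> {S, T} \<and> B \<in> {S, T}")
      case True
      then have out: "x \<in> \<Omega> - \<Gamma>" "y \<in> \<Omega> - \<Gamma>"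
        using diff[OF cl(1,2) AB(1)] diff[OF cl(2,3) AB(2)] xy xy\<Omega> by blast+
      have "(SOME c. \<exists>\<Gamma>\<in>\<Omega> // F. \<exists>x\<in>\<Omega> - \<Gamma>. \<exists>y\<in>\<Omega> - \<Gamma>. (x, y) \<in> R \<and> c = N \<Gamma> A B x y) = N \<Gamma> A B x y"
      proof (rule some_equality)
        show "\<exists>\<Gamma>'\<in>\<Omega> // F. \<exists>x'\<in>\<Omega> - \<Gamma>'. \<exists>y'\<in>\<Omega> - \<Gamma>'. (x', y') \<in> R \<and> N \<Gamma> A B x y = N \<Gamma>' A B x' y'"
          using cl out R by blast
      next
        fix c assume "\<exists>\<Gamma>\<in>\<Omega> // F. \<exists>x\<in>\<Omega> - \<Gamma>. \<exists>y\<in>\<Omega> - \<Gamma>. (x, y) \<in> R \<and> c = N \<Gamma> A B x y"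
        then obtain \<Gamma>' x' y' where "\<Gamma>' \<in> \<Omega> // F" "x' \<in> \<Omega> - \<Gamma>'" "y' \<in> \<Omega> - \<Gamma>'" "(x', y') \<in> R" "c = N \<Gamma>' A B x' y'"
          by blast
        then show "c = N \<Gamma> A B x y"
          using N_const[of \<Gamma>' x' y' \<Gamma> x y R A B] cl out R True by blast
      qed
      then show ?thesis
        using True by (simp add: a_def N_def)
    next
      case False
      \<comment> \<open>A step inside \<open>F\<close> ties the midpoint to the class of an end
        point, which is \<Gamma>, so restricting midpoints to \<Gamma> loses no path.\<close>
      have "{z \<in> \<Gamma>. (x, z) \<in> A \<and> (z, y) \<in> B} = {z \<in> \<Omega>. (x, z) \<in> A \<and> (z, y) \<in> B}"
      proof (cases "A \<in> {S, T}")
        case True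
        then have "B \<notin> {S, T}" using False by blast
        then have "\<Gamma> = \<Lambda>" "B \<subseteq> F"
          using same[OF cl(2,3) AB(2)] QF AB' by blast+
        then have "\<Gamma> = F `` {y}"
          using class_eq cl xy by blast
        then show ?thesis
          using \<open>B \<subseteq> F\<close> F_sym F_\<Omega> by blast
      next
        case False
        then have "\<Delta> = \<Gamma>" "A \<subseteq> F"
          using same[OF cl(1,2) AB(1)] QF AB' by blast+
        then have "\<Gamma> = F `` {x}"
          using class_eq cl xy by blast
        then show ?thesis
          using \<open>A \<subseteq> F\<close> F_\<Omega> by blast
      qed
      then show ?thesis
        using card_paths[OF AB' R] by (simp only: a_def if_not_P[OF False])
    qed
  qed
  note blocks = this[folded uniform_blocks_iff[OF equiv_F, of a]]
  have "parabolic \<Omega> \<R> F"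
    unfolding parabolic_def using equiv_F rels_mem F_eq E_eq
    by (intro conjI exI[of _ "{Id_on \<Omega>, R1, R2}"]) auto
  moreover have "F \<noteq> Id_on \<Omega>"
    using F_eq R2_E E_eq rel_nonempty[OF rels_mem(3)] by blast
  ultimately show ?thesis
    unfolding uniform_def using association_scheme_axioms symmetric_imp_commutative[OF symmetric] cork_F blocks
    by blast
qed

section \<open>The criterion and its form in the parameters\<close>

lemma uniform_iff_eigenvalue:
  assumes "proper_nontrivial_parabolics \<Omega> \<R> = {E, F}"
  shows "uniform \<Omega> \<R> \<longleftrightarrow> (\<exists>\<delta>. \<delta>\<^sup>2 = D \<and> e = (real f - 2) * \<delta>)"
proof
  assume "uniform \<Omega> \<R>"
  then show "\<exists>\<delta>. \<delta>\<^sup>2 = D \<and> e = (real f - 2) * \<delta>"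
    using eigenvalue_if_path_sum_independent path_sum_independent_if_uniform assms by presburger
qed (use uniform_if_eigenvalue in blast)

text \<open>By the choice of \<open>e\<close>, \<open>t\<close> is affine in \<open>e\<close> with
  slope \<open>r / n\<close>, and the formula with \<delta> in place of the signed root says that
  \<open>e = (f - 2) \<delta>\<close>. The sign \<epsilon> selects one of the two square roots of
  \<open>D\<close>.\<close>

lemma eigenvalue_iff_parameter:
  fixes k t :: nat
  assumes k: "k = m * r" and t: "t = intersection_number \<Omega> T S T"
  shows "(\<exists>\<delta>. \<delta>\<^sup>2 = D \<and> e = (real f - 2) * \<delta>) \<longleftrightarrow>
    (\<exists>\<epsilon> \<in> {1, -1 :: real}.
      real t = real k * (real f - 2) / (real m * real n) *
        (real m * real n - real k +
          \<epsilon> * sqrt (real k * (real m * real n - real k) / (real m * (real n - 1)))))"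
proof -
  have pos: "real m > 0" "real n > 0" "real r > 0" "real n - 1 > 0"
    using m_pos n_pos r_pos r_less by simp_all
  have "real k * (real m * real n - real k) / (real m * (real n - 1)) = D"
    using pos by (simp add: k D_def field_simps)
  moreover have "real t = real k * (real f - 2) / (real m * real n) * (real m * real n - real k + \<delta>) \<longleftrightarrow>
      e = (real f - 2) * \<delta>" for \<delta>
  proof -
    have "real t = real r / real n * ((real f - 2) * (real m * (real n - real r)) + e)"
      using pos by (simp add: e_def t)
    moreover have "real k * (real f - 2) / (real m * real n) * (real m * real n - real k + \<delta>) =
        real r / real n * ((real f - 2) * (real m * (real n - real r)) + (real f - 2) * \<delta>)"
      using pos by (simp add: k field_simps)
    ultimately show ?thesis
      using pos by simp
  qed
  moreover have "\<delta>\<^sup>2 = D \<longleftrightarrow> \<delta> = sqrt D \<or> \<delta> = - sqrt D" for \<delta>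
    using D_pos by (metis abs_of_pos less_eq_real_def power2_eq_iff real_sqrt_abs real_sqrt_pow2)
  ultimately show ?thesis
    by auto
qed

end

section \<open>Higmanian schemes\<close>

text \<open>Rank 5 leaves room for just one relation in \<open>E\<close> besides the diagonal and
  one in \<open>F\<close> outside \<open>E\<close>. Indecomposability yields a point and an
  \<open>E\<close>-class that it meets along both \<open>S\<close> and \<open>T\<close>; this class
  determines \<open>r\<close>.\<close>

lemma higmanian_two_level:
  fixes \<Omega> :: "'a set" and f m n k t :: nat
  assumes hig: "higmanian \<Omega> \<R> E F"
    and ST: "{R \<in> \<R>. \<not> R \<subseteq> F} = {S, T}" "S \<noteq> T"
    and params: "higmanian_parameters \<Omega> E F S T f m n k t"
    and f: "f \<ge> 2" and m: "m \<ge> 2" and n: "n \<ge> 2"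
  obtains R1 R2 r where "two_level_scheme \<Omega> \<R> E F R1 R2 S T f m n r" "k = m * r"
proof -
  interpret association_scheme \<Omega> \<R>
    using hig by (simp add: higmanian_def)
  have sym: "symmetric_scheme \<R>" and indec: "indecomposable \<Omega> \<R>" and five: "card \<R> = 5"
    and par: "proper_nontrivial_parabolics \<Omega> \<R> = {E, F}" and EF: "E \<subset> F"
    using hig by (auto simp: higmanian_def)
  have E: "parabolic \<Omega> \<R> E" "E \<noteq> Id_on \<Omega>" "E \<noteq> \<Omega> \<times> \<Omega>" and F: "parabolic \<Omega> \<R> F"
    using par by (auto simp: proper_nontrivial_parabolics_def)
  have eqE: "equiv \<Omega> E" and eqF: "equiv \<Omega> F"
    using E F by (auto simp: parabolic_def)
  have sub_or_disjoint: "R \<subseteq> G \<or> R \<inter> G = {}" if "R \<in> \<R>" "parabolic \<Omega> \<R> G" for R G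
    using that rel_sub_or_disjoint unfolding parabolic_def by blast
  have mem: "S \<in> \<R>" "T \<in> \<R>" "\<not> S \<subseteq> F" "\<not> T \<subseteq> F"
    using ST by blast+
  have S_F: "S \<inter> F = {}" and T_F: "T \<inter> F = {}"
    using sub_or_disjoint F mem by blast+
  have S_T: "S \<inter> T = {}"
    using rel_unique mem ST(2) by blast
  have Id_E: "Id_on \<Omega> \<subseteq> E"
    using eqE by (auto simp: equiv_def refl_on_def)
  have E_sub: "E \<subseteq> \<Omega> \<times> \<Omega>" and F_sub: "F \<subseteq> \<Omega> \<times> \<Omega>"
    using eqE eqF by (auto simp: equiv_def refl_on_def)

  obtain p where p: "p \<in> E" "p \<notin> Id_on \<Omega>"
    using Id_E E(2) by blast
  then obtain R1 where R1: "R1 \<in> \<R>" "p \<in> R1"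
    using rel_containing E_sub by blast
  have R1_E: "R1 \<subseteq> E" "R1 \<noteq> Id_on \<Omega>"
    using sub_or_disjoint[OF R1(1) E(1)] p R1 by blast+
  obtain p' where p': "p' \<in> F" "p' \<notin> E"
    using EF by blast
  then obtain R2 where R2: "R2 \<in> \<R>" "p' \<in> R2"
    using rel_containing F_sub by blast
  have R2_F: "R2 \<subseteq> F" and R2_E: "R2 \<inter> E = {}"
    using sub_or_disjoint[OF R2(1) F] sub_or_disjoint[OF R2(1) E(1)] p' R2 by blast+
  have R1_Id: "R1 \<inter> Id_on \<Omega> = {}"
    using rel_unique[OF R1(1) diagonal] R1_E(2) by blast
  have ne: "R1 \<noteq> R2" "R2 \<noteq> Id_on \<Omega>" "S \<notin> {Id_on \<Omega>, R1, R2}" "T \<notin> {Id_on \<Omega>, R1, R2}"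
    using R1_E R2_E R2_F Id_E EF mem p' R2 by blast+
  have rels: "\<R> = {Id_on \<Omega>, R1, R2, S, T}"
  proof (rule card_seteq[symmetric])
    show "finite \<R>" by (rule finite_rels)
    show "{Id_on \<Omega>, R1, R2, S, T} \<subseteq> \<R>"
      using diagonal R1 R2 mem by simp
    have "distinct [Id_on \<Omega>, R1, R2, S, T]"
      using ne R1_E(2) ST(2) by auto
    from distinct_card[OF this] show "card \<R> \<le> card {Id_on \<Omega>, R1, R2, S, T}"
      unfolding five by simp
  qed
  have E_eq: "E = Id_on \<Omega> \<union> R1"
  proof
    show "E \<subseteq> Id_on \<Omega> \<union> R1"
    proof
      fix q assume q: "q \<in> E"
      then obtain R where R: "R \<in> \<R>" "q \<in> R"
        using rel_containing E_sub by blast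
      then have "R \<noteq> R2" "R \<noteq> S" "R \<noteq> T"
        using q R2_E S_F T_F EF by blast+
      then show "q \<in> Id_on \<Omega> \<union> R1"
        using R rels by blast
    qed
  qed (use Id_E R1_E in blast)
  have F_eq: "F = E \<union> R2"
  proof
    show "F \<subseteq> E \<union> R2"
    proof
      fix q assume q: "q \<in> F"
      then obtain R where R: "R \<in> \<R>" "q \<in> R"
        using rel_containing F_sub by blast
      then have "R \<noteq> S" "R \<noteq> T"
        using q S_F T_F by blast+
      then show "q \<in> E \<union> R2"
        using R rels E_eq by blast
    qed
  qed (use EF R2_F in blast)

  have n_eq: "class_size \<Omega> E = n" and rm: "real m = real (class_size \<Omega> F) / real (class_size \<Omega> E)"
    and rf: "real f = real (card \<Omega>) / real (class_size \<Omega> F)"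
    using params by (simp_all add: higmanian_parameters_def)
  have "real (class_size \<Omega> F) = real (m * n)"
    using rm n n_eq by (simp add: field_simps)
  then have F_size: "class_size \<Omega> F = m * n"
    by linarith
  have "real (card \<Omega>) = real (f * (m * n))"
    using rf n m F_size by (simp add: field_simps)
  then have "card \<Omega> = f * (m * n)"
    by (rule of_nat_eq_iff[THEN iffD1])
  then have "f * (m * n) = card (\<Omega> // F) * (m * n)"
    using card_quotient_class_size[OF F] unfolding F_size by (rule trans[OF HOL.sym])
  moreover have "m * n \<noteq> 0"
    using m n by simp
  ultimately have card_quot: "card (\<Omega> // F) = f"
    using mult_cancel2 by metis
  have card_E: "card (E `` {x}) = n" if "x \<in> \<Omega>" for x
    using card_class[OF E(1) that] n_eq by simp
  have card_F: "card (F `` {x}) = m * n" if "x \<in> \<Omega>" for x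
    using card_class[OF F that] F_size by simp

  have symR: "(x, y) \<in> R \<longleftrightarrow> (y, x) \<in> R" if "R \<in> \<R>" for x y R
    using sym that unfolding symmetric_scheme_def by blast
  have symE: "(y, x) \<in> E" if "(x, y) \<in> E" for x y
    using eqE that by (meson equivE symD)
  have E_right: "(x, y) \<in> E \<longleftrightarrow> (x, y') \<in> E" if "(y, y') \<in> E" for x y y'
    using eqE that by (meson equivE symD transD)
  have F_right: "(x, y) \<in> F \<longleftrightarrow> (x, y') \<in> F" if "(y, y') \<in> E" for x y y'
    using eqF that EF by (meson equivE psubsetD symD transD)
  have not_F: "(x, y) \<in> S \<or> (x, y) \<in> T" if "x \<in> \<Omega>" "y \<in> \<Omega>" "(x, y) \<notin> F" for x y
    using rel_exists[OF that(1,2)] that(3) unfolding rels F_eq E_eq by blast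

  \<comment> \<open>Otherwise moving the second point within its \<open>E\<close>-class would
    preserve \<open>T\<close>, hence also \<open>S\<close> and \<open>R2\<close>. Symmetry extends
    this to the first point, and the scheme would be a wreath product.\<close>
  have "\<exists>x y y'. (x, y) \<in> T \<and> (y, y') \<in> E \<and> (x, y') \<notin> T"
  proof (rule ccontr)
    assume "\<not> ?thesis"
    then have T_sat: "(x, y') \<in> T" if "(x, y) \<in> T" "(y, y') \<in> E" for x y y'
      using that by blast
    have S_sat: "(x, y') \<in> S" if "(x, y) \<in> S" "(y, y') \<in> E" for x y y'
    proof (rule ccontr)
      assume nS: "(x, y') \<notin> S"
      have "x \<in> \<Omega>" "y' \<in> \<Omega>"
        using that rel_subset[OF mem(1)] E_sub by blast+
      moreover have "(x, y') \<notin> F"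
        using F_right[OF that(2)] that(1) S_F by blast
      ultimately have "(x, y') \<in> T"
        using not_F nS by blast
      then have "(x, y) \<in> T"
        using T_sat symE[OF that(2)] by blast
      then show False using that S_T by blast
    qed
    have R2_sat: "(x, y') \<in> R2" if "(x, y) \<in> R2" "(y, y') \<in> E" for x y y'
    proof -
      have "(x, y') \<in> F" "(x, y') \<notin> E"
        using that(1) F_right[OF that(2)] E_right[OF that(2)] R2_F R2_E by blast+
      then show ?thesis using F_eq by blast
    qed
    have right: "(x, y') \<in> R" if "R \<in> \<R> - {Id_on \<Omega>, R1}" "(x, y) \<in> R" "(y, y') \<in> E" for R x y y'
    proof -
      have "R = R2 \<or> R = S \<or> R = T" using that(1) rels by blast
      then show ?thesis using R2_sat S_sat T_sat that(2,3) by blast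
    qed
    have "\<not> indecomposable \<Omega> \<R>"
    proof (rule decomposable_if_saturated[OF sym eqE R1(1) R1_E(2) E_eq card_E n E(3)])
      fix R x y x' y' assume R: "R \<in> \<R> - {Id_on \<Omega>, R1}" and "(x, y) \<in> R" "(x, x') \<in> E" "(y, y') \<in> E"
      then have "(y', x) \<in> R"
        using right[OF R] symR[of R] by blast
      then have "(y', x') \<in> R"
        using right[OF R] \<open>(x, x') \<in> E\<close> by blast
      then show "(x', y') \<in> R"
        using symR[of R] R by blast
    qed
    then show False using indec by contradiction
  qed
  then obtain x0 y0 y1 where x0: "(x0, y0) \<in> T" "(y0, y1) \<in> E" "(x0, y1) \<notin> T"
    by blast
  have x0\<Omega>: "x0 \<in> \<Omega>" "y0 \<in> \<Omega>" "y1 \<in> \<Omega>"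
    using x0 rel_subset[OF mem(2)] E_sub by auto
  have "(x0, y1) \<notin> F"
    using F_right[OF x0(2)] x0(1) T_F by blast
  then have x0S: "(x0, y1) \<in> S"
    using not_F x0 x0\<Omega> by blast

  \<comment> \<open>The points counted are the midpoints of paths from \<open>x\<close> to
    \<open>y\<close> with one step in \<open>S\<close> and one in \<open>E\<close>, so their number
    depends only on the relation containing \<open>(x, y)\<close>.\<close>
  have count: "card (S `` {x} \<inter> E `` {y}) = card (S `` {x'} \<inter> E `` {y'})"
    if U: "U \<in> \<R>" "(x, y) \<in> U" "(x', y') \<in> U" for U x y x' y'
  proof -
    have "S `` {u} \<inter> E `` {v} = {z \<in> \<Omega>. (u, z) \<in> \<Union>{S} \<and> (z, v) \<in> \<Union>{Id_on \<Omega>, R1}}" for u v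
      using rel_subset[OF mem(1)] symE E_eq by auto
    moreover have "{S} \<subseteq> \<R>" "{Id_on \<Omega>, R1} \<subseteq> \<R>"
      using mem diagonal R1 by auto
    ultimately show ?thesis
      using card_paths_Union[of "{S}" "{Id_on \<Omega>, R1}" U] U by simp
  qed
  \<comment> \<open>A priori \<open>S\<close> and \<open>T\<close> give two constants. They coincide
    because \<open>y0\<close> and \<open>y1\<close> share an \<open>E\<close>-class, while
    \<open>(x0, y0)\<close> is in \<open>T\<close> and \<open>(x0, y1)\<close> in \<open>S\<close>.
    The same two points show that \<open>r < n\<close> and \<open>0 < r\<close>.\<close>
  define r where "r = card (S `` {x0} \<inter> E `` {y0})"
  have r1: "card (S `` {x0} \<inter> E `` {y1}) = r"
    using equiv_class_eq[OF eqE x0(2)] by (simp add: r_def)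
  have card_S_E: "card (S `` {x} \<inter> E `` {y}) = r" if "x \<in> \<Omega>" "y \<in> \<Omega>" "(x, y) \<notin> F" for x y
    using not_F[OF that] count[OF mem(1) _ x0S] count[OF mem(2) _ x0(1)] r1 by (auto simp: r_def)
  have finE: "finite (E `` {y0})"
    using E_sub finite_points by (auto intro: finite_subset[of _ \<Omega>])
  have "y1 \<in> S `` {x0} \<inter> E `` {y0}"
    using x0 x0S by blast
  then have r_pos: "0 < r"
    unfolding r_def using finE by (auto simp: card_gt_0_iff)
  have "y0 \<in> E `` {y0}" "y0 \<notin> S `` {x0}"
    using x0 S_T Id_E x0\<Omega> by blast+
  then have "r < card (E `` {y0})"
    unfolding r_def using finE by (intro psubset_card_mono) auto
  then have r_less: "r < n"
    using card_E x0\<Omega> by simp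
  have scheme: "two_level_scheme \<Omega> \<R> E F R1 R2 S T f m n r"
    by unfold_locales (fact sym rels E_eq F_eq eqE eqF R2_E R1_Id S_F T_F S_T card_E card_F card_quot
        card_S_E r_pos r_less f | use m in simp)+
  interpret two_level_scheme \<Omega> \<R> E F R1 R2 S T f m n r
    by (rule scheme)
  \<comment> \<open>A point outside some class is what makes the value described by
    \<open>THE\<close> unique.\<close>
  have "F `` {x0} \<in> \<Omega> // F" "y0 \<notin> F `` {x0}"
    using x0 x0\<Omega> T_F by (auto intro: quotientI)
  then have "(THE c. \<forall>x \<in> \<Omega>. \<forall>\<Delta> \<in> \<Omega> // F. x \<notin> \<Delta> \<longrightarrow> card {y \<in> \<Delta>. (x, y) \<in> S} = c) = m * r"
    using card_S_class(1) x0\<Omega> by (intro the_equality) blast+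
  then have "k = m * r"
    using params by (simp add: higmanian_parameters_def)
  with scheme show ?thesis by (rule that)
qed

theorem theorem1:
  fixes \<Omega> :: "'a set" and \<R> :: "'a rel set" and E F S T :: "'a rel"
    and f m n k t :: nat
  assumes "higmanian \<Omega> \<R> E F"
    and "{R \<in> \<R>. \<not> R \<subseteq> F} = {S, T}" and "S \<noteq> T"
    and "valency \<Omega> T \<le> valency \<Omega> S"
    and "higmanian_parameters \<Omega> E F S T f m n k t"
    and "f \<ge> 2" and "m \<ge> 2" and "n \<ge> 2"
  shows "uniform \<Omega> \<R> \<longleftrightarrow>
    (\<exists>\<epsilon> \<in> {1, -1 :: real}.
      real t = real k * (real f - 2) / (real m * real n) *
        (real m * real n - real k +
          \<epsilon> * sqrt (real k * (real m * real n - real k) / (real m * (real n - 1)))))"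
proof -
  obtain R1 R2 r where scheme: "two_level_scheme \<Omega> \<R> E F R1 R2 S T f m n r" and k: "k = m * r"
    using higmanian_two_level[OF assms(1-3,5-8)] .
  interpret two_level_scheme \<Omega> \<R> E F R1 R2 S T f m n r
    by (rule scheme)
  have "proper_nontrivial_parabolics \<Omega> \<R> = {E, F}"
    using assms(1) by (simp add: higmanian_def)
  moreover have "t = intersection_number \<Omega> T S T"
    using assms(5) by (simp add: higmanian_parameters_def)
  ultimately show ?thesis
    using uniform_iff_eigenvalue eigenvalue_iff_parameter[OF k] by simp
qed

end
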